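(* Let $\epsilon>0$, let $a\in\mathbb{Z}$ with $a\ne0$, and let $d\in\mathbb{N}$. For a positive proportion of polynomials $P(t)\in\mathbb{Z}[t]$ of degree $d$ (ordered by height), the equation $x^2-ay^2=P(t)z^2$ has a solution $(x,y,z,t)\in\mathbb{N}^4$ with $$\max\{x,y,z,t\}\le|a|^{1/2}|P|^{1/2}(\log|P|)^{d/2+\epsilon}.$$
   Context: $\mathbb{N}$ is the set of positive integers. The height $|P|$ of $P\in\mathbb{Z}[t]$ is the maximum of the absolute values of its coefficients. "For a positive proportion" means that the proportion, among all integer polynomials of degree $d$ and height at most $H$, of those with the property has positive $\liminf$ as $H\to\infty$. *)

theory Defs
  imports "HOL-Analysis.Analysis" "HOL-Computational_Algebra.Polynomial"
begin

definition height :: "int poly \<Rightarrow> int" where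
  "height P = Max ((\<lambda>i. \<bar>coeff P i\<bar>) ` {..degree P})"

definition polys_of_height_at_most :: "nat \<Rightarrow> nat \<Rightarrow> int poly set" where
  "polys_of_height_at_most d H = {P. degree P = d \<and> height P \<le> int H}"

lemma finite_polys_of_height_at_most: "finite (polys_of_height_at_most d H)"
proof -
  let ?L = "{xs. set xs \<subseteq> {- int H..int H} \<and> length xs = Suc d}"
  have "polys_of_height_at_most d H \<subseteq> Poly ` ?L"
  proof
    fix P assume P: "P \<in> polys_of_height_at_most d H"
    let ?xs = "map (coeff P) [0..<Suc d]"
    have deg: "degree P = d" and hgt: "height P \<le> int H"
      using P by (auto simp: polys_of_height_at_most_def)
    have "\<bar>coeff P i\<bar> \<le> int H" if "i \<le> d" for i
    proof -
      have "\<bar>coeff P i\<bar> \<le> height P"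
        unfolding height_def using that deg by (intro Max_ge) auto
      then show ?thesis using hgt by simp
    qed
    then have "set ?xs \<subseteq> {- int H..int H}"
      by (fastforce simp: abs_le_iff less_Suc_eq_le simp del: upt_Suc)
    moreover have "P = Poly ?xs"
      by (rule poly_eqI)
        (use deg in \<open>auto simp: coeff_Poly_eq nth_default_def coeff_eq_0 simp del: upt_Suc\<close>)
    ultimately show "P \<in> Poly ` ?L"
      by (intro image_eqI[of _ _ ?xs] CollectI conjI) simp_all
  qed
  then show ?thesis
    by (rule finite_subset) (intro finite_imageI finite_lists_length_eq, simp)
qed

text \<open>The height is an integer, so a natural number bound \<open>H\<close> loses nothing compared to a real
  one. The lower limit is taken in the extended reals, where it always exists; for \<open>H = 0\<close> and
  \<open>d > 0\<close> the quotient is \<open>0 / 0 = 0\<close>, which does not affect it.\<close>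

definition positive_proportion :: "nat \<Rightarrow> (int poly \<Rightarrow> bool) \<Rightarrow> bool" where
  "positive_proportion d Q \<longleftrightarrow>
     0 < liminf (\<lambda>H. ereal (real (card {P \<in> polys_of_height_at_most d H. Q P}) /
                            real (card (polys_of_height_at_most d H))))"

end

theory Submission
  imports Defs "HOL-Number_Theory.Cong" "HOL-Real_Asymp.Real_Asymp"
begin

text \<open>A second moment argument with \<open>z = 1\<close>. Let \<open>h = H div 2\<close> and \<open>T = \<lceil>ln h\<rceil>\<close>, let the
  coefficients of \<open>P\<close> range over \<open>{h..<2 h}\<close>, and let \<open>N(P)\<close> count the triples \<open>(t, x, y)\<close> with
  \<open>T \<le> t < 2 T\<close>, \<open>x\<close> and \<open>y\<close> of order \<open>\<surd>(h T^d)\<close> and \<open>x\<^sup>2 - a y\<^sup>2 = P(t)\<close>. Counting squares in the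
  interval swept out by the constant coefficient shows that the mean of \<open>N\<close> is at least a constant
  times \<open>T\<close>. In the second moment, the pairs with \<open>t\<^sub>1 = t\<^sub>2\<close> contribute on average \<open>O(T ln h)\<close>,
  because \<open>(x\<^sub>1 - x\<^sub>2) (x\<^sub>1 + x\<^sub>2) = (y\<^sub>1 - y\<^sub>2) (a (y\<^sub>1 + y\<^sub>2))\<close> has \<open>O(S\<^sup>2 ln S)\<close> solutions in a box of
  side \<open>S\<close>. For \<open>t\<^sub>1 \<noteq> t\<^sub>2\<close> the two values are congruent modulo \<open>q = |t\<^sub>1 - t\<^sub>2|\<close> and determine the
  two lowest coefficients, and the number of solutions of the congruence modulo \<open>q\<close> is \<open>O(q\<^sup>3)\<close> on
  average over \<open>q\<close> (for given differences of the coordinates the congruence is linear), so that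
  these pairs contribute \<open>O(T\<^sup>2)\<close>. As \<open>T \<ge> ln h\<close>, the Cauchy--Schwarz inequality gives \<open>N(P) > 0\<close>
  for a positive proportion of \<open>P\<close>.\<close>

subsection \<open>Counting integers\<close>

lemma card_eq_sum_card_fibres:
  assumes "finite A" "finite B" "f ` A \<subseteq> B"
  shows "card A = (\<Sum>y\<in>B. card {x \<in> A. f x = y})"
  using sum.group[OF assms, of "\<lambda>_. 1 :: nat"] by simp

lemma card_le_card_image_times_fibre:
  assumes "finite A" "\<And>y. y \<in> f ` A \<Longrightarrow> real (card {x \<in> A. f x = y}) \<le> m"
  shows "real (card A) \<le> real (card (f ` A)) * m"
proof -
  have "real (card A) = (\<Sum>y\<in>f ` A. real (card {x \<in> A. f x = y}))"
    using card_eq_sum_card_fibres[of A "f ` A" f] assms(1) by simp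
  also have "\<dots> \<le> real (card (f ` A)) * m"
    using assms(2) by (rule sum_bounded_above)
  finally show ?thesis .
qed

lemma card_congruent_le:
  fixes A :: "int set" and q :: int
  assumes "finite A" "q > 0" "L \<ge> 0"
    and cong: "\<And>x y. x \<in> A \<Longrightarrow> y \<in> A \<Longrightarrow> [x = y] (mod q)"
    and diff: "\<And>x y. x \<in> A \<Longrightarrow> y \<in> A \<Longrightarrow> real_of_int (x - y) \<le> L"
  shows "real (card A) \<le> L / q + 1"
proof (cases "A = {}")
  case False
  define l where "l = Min A"
  have least: "l \<in> A" "\<And>x. x \<in> A \<Longrightarrow> l \<le> x"
    using \<open>finite A\<close> False by (auto simp: l_def)
  have "A \<subseteq> (\<lambda>k. l + q * k) ` {0..\<lfloor>L / q\<rfloor>}"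
  proof
    fix x assume x: "x \<in> A"
    obtain k where quotient: "x - l = q * k"
      using cong[OF x least(1)] by (auto simp: cong_iff_dvd_diff)
    have "k \<ge> 0"
      using least(2)[OF x] quotient \<open>q > 0\<close> by (metis diff_ge_0_iff_ge zero_le_mult_iff linorder_not_le)
    moreover have "real_of_int k * q \<le> L"
      using diff[OF x least(1)] unfolding quotient by (simp add: mult.commute)
    then have "k \<le> \<lfloor>L / q\<rfloor>"
      using \<open>q > 0\<close> by (simp add: le_floor_iff pos_le_divide_eq)
    ultimately show "x \<in> (\<lambda>k. l + q * k) ` {0..\<lfloor>L / q\<rfloor>}"
      using quotient by (intro image_eqI[of _ _ k]) auto
  qed
  then have "card A \<le> card {0..\<lfloor>L / q\<rfloor>}"
    by (rule surj_card_le[rotated]) simp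
  also have "real \<dots> \<le> L / q + 1" using assms by simp
  finally show ?thesis by simp
qed (use assms in auto)

lemma card_le_congruent_image_times_fibre:
  fixes f :: "'a \<Rightarrow> int" and q :: int
  assumes "finite A" "q > 0" "L \<ge> 0" "m \<ge> 0"
    and "\<And>u v. u \<in> A \<Longrightarrow> v \<in> A \<Longrightarrow> [f u = f v] (mod q)"
    and "\<And>u v. u \<in> A \<Longrightarrow> v \<in> A \<Longrightarrow> real_of_int (f u - f v) \<le> L"
    and fibre: "\<And>n. real (card {u \<in> A. f u = n}) \<le> m"
  shows "real (card A) \<le> (L / q + 1) * m"
proof -
  have "real (card A) \<le> real (card (f ` A)) * m"
    using assms(1) fibre by (rule card_le_card_image_times_fibre)
  also have "\<dots> \<le> (L / q + 1) * m"
    using assms by (intro mult_right_mono card_congruent_le) auto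
  finally show ?thesis .
qed

lemma card_multiples_le:
  fixes e n :: int
  assumes "e > 0" "n \<ge> 0"
  shows "real (card {x \<in> {1..n}. e dvd x}) \<le> n / e"
proof -
  have "{x \<in> {1..n}. e dvd x} \<subseteq> (\<lambda>k. e * k) ` {1..n div e}"
  proof
    fix x assume "x \<in> {x \<in> {1..n}. e dvd x}"
    then obtain k where multiple: "x = e * k" "1 \<le> e * k" "e * k \<le> n" by auto
    moreover have "k \<ge> 1"
      using multiple(2) \<open>e > 0\<close> by (simp add: int_one_le_iff_zero_less zero_less_mult_iff)
    moreover have "k \<le> n div e" using multiple(3) \<open>e > 0\<close> zdiv_mono1[of "e * k" n e] by simp
    ultimately show "x \<in> (\<lambda>k. e * k) ` {1..n div e}" by auto
  qed
  then have "card {x \<in> {1..n}. e dvd x} \<le> card {1..n div e}"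
    by (rule surj_card_le[rotated]) simp
  also have "real \<dots> \<le> n / e"
    using assms real_of_int_div4[of n e] by (simp add: pos_imp_zdiv_nonneg_iff)
  finally show ?thesis by simp
qed

lemma card_linear_congruence_le:
  fixes b m g q :: int
  assumes "g > 0" "q > 0" "g dvd q"
  shows "real (card {z \<in> {0..<q}. g dvd b * z + m}) \<le> real_of_int ((q div g) * gcd b g)"
    (is "real (card ?A) \<le> _")
proof -
  define e where "e = gcd b g"
  obtain k where q_eq: "q = g * k" using \<open>g dvd q\<close> by blast
  obtain b' g' where b_eq: "b = b' * e" and g_eq: "g = g' * e" and "coprime b' g'"
    using \<open>g > 0\<close> unfolding e_def by (metis gcd_coprime_exists less_irrefl gcd_eq_0_iff)
  have "e > 0" using \<open>g > 0\<close> by (simp add: e_def)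
  then have "g' > 0" using \<open>g > 0\<close> by (simp add: g_eq zero_less_mult_iff)
  have "real (card ?A) \<le> real_of_int (q - 1) / g' + 1"
  proof (rule card_congruent_le)
    fix x y assume "x \<in> ?A" "y \<in> ?A"
    then have "g dvd (b * x + m) - (b * y + m)" by (intro dvd_diff) auto
    then have "g' * e dvd (b' * (x - y)) * e" by (simp add: b_eq g_eq algebra_simps)
    then show "[x = y] (mod g')"
      using \<open>e > 0\<close> \<open>coprime b' g'\<close>
      by (simp add: cong_iff_dvd_diff coprime_commute coprime_dvd_mult_right_iff)
  next
    fix x y assume "x \<in> ?A" "y \<in> ?A"
    then show "real_of_int (x - y) \<le> real_of_int (q - 1)" by auto
  qed (use \<open>q > 0\<close> \<open>g' > 0\<close> in \<open>simp_all del: atLeastLessThan_iff\<close>)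
  also have "\<dots> < real_of_int (k * e) + 1"
    using \<open>g' > 0\<close> by (simp add: q_eq g_eq field_simps)
  finally have "card ?A \<le> k * e" by linarith
  then show ?thesis
    using \<open>g > 0\<close> unfolding q_eq e_def[symmetric]
    by (simp add: of_int_mult[symmetric] del: of_int_mult)
qed

lemma card_linear_congruence_pair_le:
  fixes b b' m q :: int
  assumes "q > 0"
  shows "real (card {(v, z) \<in> {0..<q} \<times> {0..<q}. q dvd b * v + b' * z + m}) \<le>
    real_of_int (q * gcd b' (gcd b q))" (is "real (card ?A) \<le> _")
proof -
  define g where "g = gcd b q"
  have g_facts: "g > 0" "g dvd q" "g dvd b" using assms by (auto simp: g_def)
  have finite_solutions: "finite ?A" by (rule finite_subset[of _ "{0..<q} \<times> {0..<q}"]) auto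
  have "real (card ?A) \<le> real (card (snd ` ?A)) * g"
  proof (rule card_le_card_image_times_fibre[OF finite_solutions])
    fix z
    have "{p \<in> ?A. snd p = z} \<subseteq> (\<lambda>v. (v, z)) ` {v \<in> {0..<q}. q dvd b * v + (b' * z + m)}"
      by (auto simp: add.assoc)
    then have "card {p \<in> ?A. snd p = z} \<le> card {v \<in> {0..<q}. q dvd b * v + (b' * z + m)}"
      by (rule surj_card_le[rotated]) (simp del: atLeastLessThan_iff)
    also have "real \<dots> \<le> g"
      using card_linear_congruence_le[of q q b "b' * z + m"] assms by (simp add: g_def)
    finally show "real (card {p \<in> ?A. snd p = z}) \<le> g" by simp
  qed
  also have "snd ` ?A \<subseteq> {z \<in> {0..<q}. g dvd b' * z + m}"
  proof clarsimp
    fix v z assume "q dvd b * v + b' * z + m"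
    then have "g dvd b * v + (b' * z + m)" using g_facts(2) by (simp add: add.assoc dvd_trans)
    then show "g dvd b' * z + m" using g_facts(3) by (simp add: dvd_add_right_iff)
  qed
  then have "real (card (snd ` ?A)) * g \<le> real (card {z \<in> {0..<q}. g dvd b' * z + m}) * g"
    using g_facts(1) by (intro mult_right_mono) (simp_all add: card_mono del: atLeastLessThan_iff)
  also have "\<dots> \<le> real_of_int (q div g * gcd b' g) * g"
    using card_linear_congruence_le[OF g_facts(1) assms g_facts(2)] g_facts(1)
    by (intro mult_right_mono) auto
  also have "\<dots> = real_of_int (q * gcd b' g)" using g_facts by (simp add: real_of_int_div)
  finally show ?thesis by (simp add: g_def)
qed

lemma card_ints_half_open_ge:
  fixes \<alpha> \<beta> :: real
  shows "\<beta> - \<alpha> - 1 \<le> real (card {x :: int. \<alpha> \<le> x \<and> x < \<beta>})"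
proof -
  have "{x :: int. \<alpha> \<le> x \<and> x < \<beta>} = {\<lceil>\<alpha>\<rceil>..<\<lceil>\<beta>\<rceil>}"
    by (auto simp: ceiling_le_iff less_ceiling_iff)
  then show ?thesis by simp linarith
qed

lemma card_squares_in_interval_ge:
  fixes \<alpha> \<beta> S :: real
  assumes "0 < \<alpha>" "\<alpha> \<le> \<beta>" "\<beta> \<le> S\<^sup>2" "0 < S"
  shows "(\<beta> - \<alpha>) / (2 * S) - 1 \<le>
    real (card {x :: int. x > 0 \<and> \<alpha> \<le> real_of_int (x\<^sup>2) \<and> real_of_int (x\<^sup>2) < \<beta>})"
proof -
  have "{x :: int. sqrt \<alpha> \<le> x \<and> x < sqrt \<beta>} =
      {x :: int. x > 0 \<and> \<alpha> \<le> real_of_int (x\<^sup>2) \<and> real_of_int (x\<^sup>2) < \<beta>}"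
  proof (rule Collect_cong)
    fix x :: int
    have "x > 0" if "sqrt \<alpha> \<le> x"
      using that \<open>0 < \<alpha>\<close> by (metis of_int_0_less_iff order_less_le_trans real_sqrt_gt_zero)
    moreover have "(sqrt \<alpha> \<le> x \<longleftrightarrow> \<alpha> \<le> real_of_int (x\<^sup>2)) \<and> (x < sqrt \<beta> \<longleftrightarrow> real_of_int (x\<^sup>2) < \<beta>)"
      if "x > 0"
    proof -
      have "sqrt (x\<^sup>2) = x" using that by simp
      then show ?thesis by (metis of_int_power real_sqrt_le_iff real_sqrt_less_iff)
    qed
    ultimately show "sqrt \<alpha> \<le> x \<and> x < sqrt \<beta> \<longleftrightarrow> x > 0 \<and> \<alpha> \<le> real_of_int (x\<^sup>2) \<and> real_of_int (x\<^sup>2) < \<beta>"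
      by blast
  qed
  moreover have "(\<beta> - \<alpha>) / (2 * S) \<le> sqrt \<beta> - sqrt \<alpha>"
  proof -
    have "sqrt \<alpha> \<le> sqrt \<beta>" "sqrt \<beta> \<le> S" using assms by (auto intro: real_le_lsqrt)
    have "\<beta> - \<alpha> = (sqrt \<beta> - sqrt \<alpha>) * (sqrt \<beta> + sqrt \<alpha>)"
      using assms by (simp add: algebra_simps)
    also have "\<dots> \<le> (sqrt \<beta> - sqrt \<alpha>) * (2 * S)"
      using \<open>sqrt \<alpha> \<le> sqrt \<beta>\<close> \<open>sqrt \<beta> \<le> S\<close> by (intro mult_left_mono) linarith+
    finally show ?thesis using assms by (simp add: field_simps)
  qed
  ultimately show ?thesis using card_ints_half_open_ge[of "sqrt \<beta>" "sqrt \<alpha>"] by simp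
qed

lemma diff_le_of_squares_diff_le:
  fixes x y S E :: "'a :: linordered_field"
  assumes "S > 0" "S \<le> x" "S \<le> y" "x\<^sup>2 - y\<^sup>2 \<le> E" "E \<ge> 0"
  shows "x - y \<le> E / (2 * S)"
proof (cases "x \<ge> y")
  case True
  then have "(x - y) * (2 * S) \<le> (x - y) * (x + y)"
    using assms by (intro mult_left_mono) auto
  also have "\<dots> \<le> E" using assms by (simp add: power2_eq_square algebra_simps)
  finally show ?thesis using assms by (simp add: field_simps)
next
  case False
  then have "x - y \<le> 0" by simp
  also have "0 \<le> E / (2 * S)" using assms by simp
  finally show ?thesis .
qed

lemma sum_squared_le_card_support_mult:
  fixes f :: "'a \<Rightarrow> real"
  assumes "finite A"
  shows "(\<Sum>x\<in>A. f x)\<^sup>2 \<le> real (card {x \<in> A. f x \<noteq> 0}) * (\<Sum>x\<in>A. (f x)\<^sup>2)"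
proof -
  let ?B = "{x \<in> A. f x \<noteq> 0}"
  have "(\<Sum>x\<in>A. f x) = (\<Sum>x\<in>?B. 1 * f x)"
    using assms by (intro sum.mono_neutral_cong_right) auto
  also have "\<dots>\<^sup>2 \<le> (\<Sum>x\<in>?B. 1\<^sup>2) * (\<Sum>x\<in>?B. (f x)\<^sup>2)" by (rule Cauchy_Schwarz_ineq_sum)
  also have "\<dots> \<le> real (card ?B) * (\<Sum>x\<in>A. (f x)\<^sup>2)"
    using assms by (auto intro!: mult_left_mono sum_mono2)
  finally show ?thesis .
qed

subsection \<open>Congruent values of the norm form\<close>

definition norm_form :: "int \<Rightarrow> int \<times> int \<Rightarrow> int" where
  "norm_form a p = (fst p)\<^sup>2 - a * (snd p)\<^sup>2"

lemma norm_form_Pair [simp]: "norm_form a (x, y) = x\<^sup>2 - a * y\<^sup>2"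
  by (simp add: norm_form_def)

definition inverse_divisor_sum :: "int \<Rightarrow> real" where
  "inverse_divisor_sum q = (\<Sum>e \<in> {e \<in> {1..q}. e dvd q}. 1 / real_of_int e)"

lemma inverse_divisor_sum_nonneg: "inverse_divisor_sum q \<ge> 0"
  by (auto simp: inverse_divisor_sum_def intro!: sum_nonneg)

lemma sum_inverse_squares_le: "(\<Sum>n = 1..N. 1 / (real n)\<^sup>2) \<le> 2 - 1 / real N"
proof (induction N)
  case (Suc N)
  show ?case
  proof (cases "N = 0")
    case False
    then have "1 / (real (Suc N))\<^sup>2 \<le> 1 / real N - 1 / real (Suc N)"
      by (simp add: divide_simps) (simp add: power2_eq_square algebra_simps)
    then show ?thesis using Suc by simp
  qed simp
qed simp

lemma sum_inverse_divisor_sum_le: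
  fixes T :: int
  assumes "T \<ge> 0"
  shows "(\<Sum>q = 1..T. inverse_divisor_sum q) \<le> 2 * T"
proof -
  have "(\<Sum>q = 1..T. inverse_divisor_sum q) =
      (\<Sum>q = 1..T. \<Sum>e | e \<in> {1..T} \<and> e dvd q. 1 / real_of_int e)"
    unfolding inverse_divisor_sum_def
    by (intro sum.cong refl) (auto dest: zdvd_imp_le)
  also have "\<dots> = (\<Sum>e = 1..T. \<Sum>q | q \<in> {1..T} \<and> e dvd q. 1 / real_of_int e)"
    by (rule sum.swap_restrict) auto
  also have "\<dots> = (\<Sum>e = 1..T. real (card {q \<in> {1..T}. e dvd q}) * (1 / e))"
    by simp
  also have "\<dots> \<le> (\<Sum>e = 1..T. T / e * (1 / e))"
    using assms by (intro sum_mono mult_right_mono card_multiples_le) auto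
  also have "\<dots> = T * (\<Sum>e = 1..T. 1 / (real_of_int e)\<^sup>2)"
    by (simp add: sum_distrib_left power2_eq_square)
  also have "(\<Sum>e = 1..T. 1 / (real_of_int e)\<^sup>2) = (\<Sum>n = 1..nat T. 1 / (real n)\<^sup>2)"
    by (rule sum.reindex_bij_witness[of _ int nat]) auto
  also have "T * \<dots> \<le> T * (2 :: real)"
    using assms by (intro mult_left_mono order_trans[OF sum_inverse_squares_le]) auto
  finally show ?thesis by simp
qed

lemma card_residue_pairs_gcd_eq_le:
  fixes e q :: int
  assumes "q > 0" "e > 0" "e dvd q"
  shows "real (card {p \<in> {0..<q} \<times> {0..<q}. gcd (snd p) (gcd (fst p) q) = e}) \<le> (q / e)\<^sup>2"
    (is "real (card ?A) \<le> _")
proof -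
  let ?N = "{u \<in> {0..<q}. e dvd 1 * u + 0}"
  have "?A \<subseteq> ?N \<times> ?N" by (auto intro: dvd_trans[OF gcd_dvd2 gcd_dvd1])
  then have "card ?A \<le> card (?N \<times> ?N)"
    by (rule card_mono[rotated]) (simp del: atLeastLessThan_iff)
  also have "real \<dots> = (real (card ?N))\<^sup>2"
    by (simp add: card_cartesian_product power2_eq_square)
  also have "\<dots> \<le> (q / e)\<^sup>2"
    using card_linear_congruence_le[OF \<open>e > 0\<close> \<open>q > 0\<close> \<open>e dvd q\<close>, of 1 0] \<open>e dvd q\<close>
    by (intro power_mono) (simp_all add: real_of_int_div)
  finally show ?thesis by simp
qed

lemma sum_gcd_le:
  fixes q :: int
  assumes "q > 0"
  shows "(\<Sum>(u, w)\<in>{0..<q} \<times> {0..<q}. real_of_int (gcd w (gcd u q))) \<le> q\<^sup>2 * inverse_divisor_sum q"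
proof -
  define B where "B = {0..<q} \<times> {0..<q}"
  define D where "D = {e \<in> {1..q}. e dvd q}"
  define g where "g = (\<lambda>(u, w). gcd w (gcd u q))"
  have "finite B" by (simp add: B_def)
  moreover have "finite D" by (rule finite_subset[of _ "{1..q}"]) (auto simp: D_def)
  moreover have "g (u, w) dvd q" "g (u, w) > 0" for u w
    using assms by (auto simp: g_def intro: dvd_trans[OF gcd_dvd2])
  then have "g ` B \<subseteq> D"
    using assms by (auto simp: D_def intro: zdvd_imp_le simp flip: int_one_le_iff_zero_less)
  ultimately have "(\<Sum>p\<in>B. real_of_int (g p)) = (\<Sum>e\<in>D. \<Sum>p\<in>{p \<in> B. g p = e}. real_of_int (g p))"
    by (rule sum.group[symmetric])
  also have "\<dots> = (\<Sum>e\<in>D. real (card {p \<in> B. g p = e}) * e)"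
    by simp
  also have "\<dots> \<le> (\<Sum>e\<in>D. (q / e)\<^sup>2 * e)"
    using card_residue_pairs_gcd_eq_le[OF assms]
    by (intro sum_mono mult_right_mono) (auto simp: D_def B_def g_def case_prod_unfold)
  also have "\<dots> = (\<Sum>e\<in>D. q\<^sup>2 * (1 / real_of_int e))"
    by (intro sum.cong) (auto simp: D_def power2_eq_square)
  also have "\<dots> = q\<^sup>2 * inverse_divisor_sum q"
    by (simp only: inverse_divisor_sum_def D_def sum_distrib_left)
  finally show ?thesis by (simp add: B_def g_def case_prod_unfold)
qed

lemma dvd_mult_gcd3:
  fixes k x y z n :: "'a :: semiring_gcd"
  assumes "n dvd k * x" "n dvd k * y" "n dvd k * z"
  shows "n dvd k * gcd x (gcd y z)"
proof -
  have "n dvd k * gcd y z"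
    using gcd_greatest[OF assms(2,3)] by (simp add: gcd_mult_left)
  then show ?thesis
    using gcd_greatest[OF assms(1)] by (metis dvd_normalize_iff gcd_mult_left)
qed

lemma gcd_multiples_le:
  fixes a u w q :: int
  assumes "a \<noteq> 0" "q > 0"
  shows "gcd (- (2 * a * w)) (gcd (2 * u) q) \<le> 2 * \<bar>a\<bar> * gcd w (gcd u q)" (is "?g \<le> _")
proof -
  have "?g dvd 2 * u" "?g dvd q" "?g dvd 2 * a * w"
    by (meson dvd_trans gcd_dvd1 gcd_dvd2) (meson dvd_trans gcd_dvd2, metis dvd_minus_iff gcd_dvd1)
  then have "?g dvd 2 * a * gcd w (gcd u q)"
    by (intro dvd_mult_gcd3) (auto simp: mult.assoc mult.left_commute[of 2])
  then have "?g \<le> \<bar>2 * a * gcd w (gcd u q)\<bar>"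
    using assms by (intro zdvd_imp_le) auto
  then show ?thesis by (simp add: abs_mult)
qed

definition congruent_norm_pairs :: "int \<Rightarrow> int \<Rightarrow> ((int \<times> int) \<times> (int \<times> int)) set" where
  "congruent_norm_pairs a q = {(p, p') \<in> ({0..<q} \<times> {0..<q}) \<times> ({0..<q} \<times> {0..<q}).
     [norm_form a p = norm_form a p'] (mod q)}"

lemma finite_congruent_norm_pairs: "finite (congruent_norm_pairs a q)"
  by (rule finite_subset[of _ "({0..<q} \<times> {0..<q}) \<times> ({0..<q} \<times> {0..<q})"])
    (auto simp: congruent_norm_pairs_def)

lemma norm_form_cong_diff_iff:
  assumes "[x - x' = u] (mod q)" "[y - y' = w] (mod q)"
  shows "[norm_form a (x, y) = norm_form a (x', y')] (mod q) \<longleftrightarrow>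
    q dvd (2 * u) * x' + (- (2 * a * w)) * y' + (u\<^sup>2 - a * w\<^sup>2)"
proof -
  have x_cong: "[x = x' + u] (mod q)" and y_cong: "[y = y' + w] (mod q)"
    using assms by (simp_all add: cong_iff_dvd_diff algebra_simps)
  have "[norm_form a (x, y) = norm_form a (x' + u, y' + w)] (mod q)"
    unfolding norm_form_Pair using x_cong y_cong by (intro cong_diff cong_mult cong_pow cong_refl)
  then have "[norm_form a (x, y) = norm_form a (x', y')] (mod q) \<longleftrightarrow>
      [norm_form a (x' + u, y' + w) = norm_form a (x', y')] (mod q)"
    by (metis cong_sym cong_trans)
  moreover have "norm_form a (x' + u, y' + w) - norm_form a (x', y') =
      (2 * u) * x' + (- (2 * a * w)) * y' + (u\<^sup>2 - a * w\<^sup>2)"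
    by (simp add: power2_eq_square algebra_simps)
  ultimately show ?thesis by (simp only: cong_iff_dvd_diff)
qed

definition difference_residues :: "int \<Rightarrow> (int \<times> int) \<times> (int \<times> int) \<Rightarrow> int \<times> int" where
  "difference_residues q = (\<lambda>((x, y), (x', y')). ((x - x') mod q, (y - y') mod q))"

lemma card_congruent_norm_pairs_fixed_difference_le:
  fixes a q u w :: int
  assumes "a \<noteq> 0" "q > 0"
  shows "real (card {z \<in> congruent_norm_pairs a q. difference_residues q z = (u, w)}) \<le>
    2 * \<bar>a\<bar> * q * real_of_int (gcd w (gcd u q))" (is "real (card ?Z) \<le> _")
proof -
  let ?V = "{(x, y) \<in> {0..<q} \<times> {0..<q}. q dvd (2 * u) * x + (- (2 * a * w)) * y + (u\<^sup>2 - a * w\<^sup>2)}"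
  have "card ?Z \<le> card ?V"
  proof (rule card_inj_on_le)
    have unique: "x = x'" if "(x - s) mod q = (x' - s) mod q" "0 \<le> x" "x < q" "0 \<le> x'" "x' < q"
      for x x' s :: int
    proof -
      have "[x = x'] (mod q)" using that(1) by (simp add: mod_eq_dvd_iff cong_iff_dvd_diff)
      then show ?thesis using that by (auto intro: cong_less_imp_eq_int)
    qed
    show "inj_on snd ?Z"
      by (rule inj_onI) (auto simp: difference_residues_def congruent_norm_pairs_def dest: unique)
    show "snd ` ?Z \<subseteq> ?V"
    proof
      fix p' assume "p' \<in> snd ` ?Z"
      then obtain x y x' y' where p'_eq: "p' = (x', y')"
        and pair: "((x, y), (x', y')) \<in> congruent_norm_pairs a q"
          "difference_residues q ((x, y), (x', y')) = (u, w)"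
        by force
      then have "[x - x' = u] (mod q)" "[y - y' = w] (mod q)" by (auto simp: difference_residues_def)
      then show "p' \<in> ?V"
        using pair(1) norm_form_cong_diff_iff[of x x' u q y y' w a]
        by (simp add: p'_eq congruent_norm_pairs_def)
    qed
    show "finite ?V" by (rule finite_subset[of _ "{0..<q} \<times> {0..<q}"]) auto
  qed
  also have "real \<dots> \<le> real_of_int (q * gcd (- (2 * a * w)) (gcd (2 * u) q))"
    using \<open>q > 0\<close> by (rule card_linear_congruence_pair_le)
  also have "\<dots> \<le> real_of_int (q * (2 * \<bar>a\<bar> * gcd w (gcd u q)))"
    unfolding of_int_le_iff using gcd_multiples_le[OF assms] \<open>q > 0\<close> by (intro mult_left_mono) auto
  finally show ?thesis by (simp add: mult_ac)
qed

lemma card_congruent_norm_pairs_le: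
  fixes a q :: int
  assumes "a \<noteq> 0" "q > 0"
  shows "real (card (congruent_norm_pairs a q)) \<le> 2 * \<bar>a\<bar> * q ^ 3 * inverse_divisor_sum q"
proof -
  let ?B = "{0..<q} \<times> {0..<q}"
  have "card (congruent_norm_pairs a q) =
      (\<Sum>p\<in>?B. card {z \<in> congruent_norm_pairs a q. difference_residues q z = p})"
    using \<open>q > 0\<close> finite_congruent_norm_pairs
    by (intro card_eq_sum_card_fibres) (auto simp: difference_residues_def)
  also have "real \<dots> \<le> (\<Sum>(u, w)\<in>?B. 2 * \<bar>a\<bar> * q * real_of_int (gcd w (gcd u q)))"
    unfolding of_nat_sum
    by (intro sum_mono) (clarsimp simp only: card_congruent_norm_pairs_fixed_difference_le[OF assms])
  also have "\<dots> = 2 * \<bar>a\<bar> * q * (\<Sum>(u, w)\<in>?B. real_of_int (gcd w (gcd u q)))"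
    by (simp add: sum_distrib_left case_prod_unfold)
  also have "\<dots> \<le> 2 * \<bar>a\<bar> * q * (q\<^sup>2 * inverse_divisor_sum q)"
    using sum_gcd_le[OF \<open>q > 0\<close>] \<open>q > 0\<close> by (intro mult_left_mono) auto
  finally show ?thesis by (simp add: power2_eq_square power3_eq_cube mult_ac)
qed

definition residue_pair :: "int \<Rightarrow> int \<times> int \<Rightarrow> int \<times> int" where
  "residue_pair q p = (fst p mod q, snd p mod q)"

lemma residue_pair_eqD:
  assumes "residue_pair q p = residue_pair q r"
  shows "[fst p = fst r] (mod q)" "[snd p = snd r] (mod q)"
  using assms by (auto simp: residue_pair_def cong_def)

lemma norm_form_residue_pair_cong: "[norm_form a (residue_pair q p) = norm_form a p] (mod q)"
  unfolding norm_form_def residue_pair_def fst_conv snd_conv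
  by (intro cong_diff cong_mult cong_pow cong_refl cong_mod_leftI)

lemma card_congruent_points_le:
  fixes W :: "(int \<times> int) set" and q :: int
  assumes "finite W" "q > 0" "\<alpha> \<ge> 0" "\<beta> \<ge> 0"
    and residues: "\<And>p r. p \<in> W \<Longrightarrow> r \<in> W \<Longrightarrow> residue_pair q p = residue_pair q r"
    and snd_diff: "\<And>p r. p \<in> W \<Longrightarrow> r \<in> W \<Longrightarrow> real_of_int (snd p - snd r) \<le> \<alpha>"
    and fst_diff: "\<And>p r. p \<in> W \<Longrightarrow> r \<in> W \<Longrightarrow> snd p = snd r \<Longrightarrow> real_of_int (fst p - fst r) \<le> \<beta>"
  shows "real (card W) \<le> (\<alpha> / q + 1) * (\<beta> / q + 1)"
proof (rule card_le_congruent_image_times_fibre[where f = snd])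
  show "real (card {p \<in> W. snd p = y}) \<le> \<beta> / q + 1" for y
  proof -
    have "inj_on fst {p \<in> W. snd p = y}" by (auto simp: inj_on_def)
    then have "real (card {p \<in> W. snd p = y}) = real (card (fst ` {p \<in> W. snd p = y}))"
      by (simp add: card_image)
    also have "\<dots> \<le> \<beta> / q + 1"
    proof (rule card_congruent_le)
      fix x x' assume "x \<in> fst ` {p \<in> W. snd p = y}" "x' \<in> fst ` {p \<in> W. snd p = y}"
      then have mem: "(x, y) \<in> W" "(x', y) \<in> W" by auto
      show "[x = x'] (mod q)" using residue_pair_eqD(1)[OF residues[OF mem]] by simp
      show "x - x' \<le> \<beta>" using fst_diff[OF mem] by simp
    qed (use assms(1,2,4) in auto)
    finally show ?thesis .
  qed
qed (use assms(1-4) snd_diff residue_pair_eqD(2)[OF residues] in auto)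

lemma card_congruent_pairs_le:
  fixes Z :: "((int \<times> int) \<times> (int \<times> int)) set" and q :: int
  assumes "finite Z" "q > 0" "\<alpha> \<ge> 0" "\<beta> \<ge> 0" "\<gamma> \<ge> 0" "\<delta> \<ge> 0"
    and residues: "\<And>p p'. (p, p') \<in> Z \<Longrightarrow> (residue_pair q p, residue_pair q p') = \<rho>"
    and snd_fst: "\<And>p p' r r'. (p, p') \<in> Z \<Longrightarrow> (r, r') \<in> Z \<Longrightarrow> real_of_int (snd p - snd r) \<le> \<alpha>"
    and fst_fst: "\<And>p p' r r'. (p, p') \<in> Z \<Longrightarrow> (r, r') \<in> Z \<Longrightarrow> snd p = snd r \<Longrightarrow>
      real_of_int (fst p - fst r) \<le> \<beta>"
    and snd_snd: "\<And>p p' r r'. (p, p') \<in> Z \<Longrightarrow> (r, r') \<in> Z \<Longrightarrow> real_of_int (snd p' - snd r') \<le> \<gamma>"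
    and fst_snd: "\<And>p p' r'. (p, p') \<in> Z \<Longrightarrow> (p, r') \<in> Z \<Longrightarrow> snd p' = snd r' \<Longrightarrow>
      real_of_int (fst p' - fst r') \<le> \<delta>"
  shows "real (card Z) \<le> ((\<alpha> / q + 1) * (\<beta> / q + 1)) * ((\<gamma> / q + 1) * (\<delta> / q + 1))"
proof -
  have residue_eq: "residue_pair q p = residue_pair q r" "residue_pair q p' = residue_pair q r'"
    if "(p, p') \<in> Z" "(r, r') \<in> Z" for p p' r r'
    using residues[OF that(1)] residues[OF that(2)] by auto
  have "real (card {z \<in> Z. fst z = p}) \<le> (\<gamma> / q + 1) * (\<delta> / q + 1)" for p
  proof -
    have "inj_on snd {z \<in> Z. fst z = p}" by (auto simp: inj_on_def)
    then have "real (card {z \<in> Z. fst z = p}) = real (card (snd ` {z \<in> Z. fst z = p}))"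
      by (simp add: card_image)
    also have "\<dots> \<le> (\<gamma> / q + 1) * (\<delta> / q + 1)"
    proof (rule card_congruent_points_le)
      fix p' r' assume "p' \<in> snd ` {z \<in> Z. fst z = p}" "r' \<in> snd ` {z \<in> Z. fst z = p}"
      then have mem: "(p, p') \<in> Z" "(p, r') \<in> Z" by auto
      show "residue_pair q p' = residue_pair q r'" using mem by (rule residue_eq(2))
      show "snd p' - snd r' \<le> \<gamma>" using mem by (rule snd_snd)
      show "fst p' - fst r' \<le> \<delta>" if "snd p' = snd r'" using mem that by (rule fst_snd)
    qed (use assms(1-6) in auto)
    finally show ?thesis .
  qed
  then have "real (card Z) \<le> real (card (fst ` Z)) * ((\<gamma> / q + 1) * (\<delta> / q + 1))"
    using \<open>finite Z\<close> by (intro card_le_card_image_times_fibre)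
  also have "\<dots> \<le> ((\<alpha> / q + 1) * (\<beta> / q + 1)) * ((\<gamma> / q + 1) * (\<delta> / q + 1))"
  proof (rule mult_right_mono)
    show "real (card (fst ` Z)) \<le> (\<alpha> / q + 1) * (\<beta> / q + 1)"
    proof (rule card_congruent_points_le)
      fix p r assume "p \<in> fst ` Z" "r \<in> fst ` Z"
      then obtain p' r' where mem: "(p, p') \<in> Z" "(r, r') \<in> Z" by auto
      show "residue_pair q p = residue_pair q r" using mem by (rule residue_eq(1))
      show "snd p - snd r \<le> \<alpha>" using mem by (rule snd_fst)
      show "fst p - fst r \<le> \<beta>" if "snd p = snd r" using mem that by (rule fst_fst)
    qed (use assms(1-6) in auto)
  qed (use assms(1-6) in simp)
  finally show ?thesis .
qed

subsection \<open>Equal values of the norm form\<close>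

definition nonzero_ints :: "int \<Rightarrow> int set" where
  "nonzero_ints N = {-N..N} - {0}"

lemma finite_nonzero_ints: "finite (nonzero_ints N)"
  by (simp add: nonzero_ints_def)

lemma card_nonzero_ints: "N \<ge> 0 \<Longrightarrow> real (card (nonzero_ints N)) = 2 * N"
  by (simp add: nonzero_ints_def)

lemma sum_inverse_nonzero_ints_le:
  fixes N :: int
  assumes "N \<ge> 1"
  shows "(\<Sum>m\<in>nonzero_ints N. 1 / real_of_int \<bar>m\<bar>) \<le> 2 * (1 + ln N)"
proof -
  have "nonzero_ints N = {1..N} \<union> {-N..-1}" by (auto simp: nonzero_ints_def)
  then have "(\<Sum>m\<in>nonzero_ints N. 1 / real_of_int \<bar>m\<bar>) =
      (\<Sum>m\<in>{1..N}. 1 / real_of_int \<bar>m\<bar>) + (\<Sum>m\<in>{-N..-1}. 1 / real_of_int \<bar>m\<bar>)"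
    by (simp only:) (rule sum.union_disjoint, auto)
  also have "(\<Sum>m\<in>{-N..-1}. 1 / real_of_int \<bar>m\<bar>) = (\<Sum>m\<in>{1..N}. 1 / real_of_int \<bar>m\<bar>)"
    by (rule sum.reindex_bij_witness[of _ uminus uminus]) auto
  also have "(\<Sum>m\<in>{1..N}. 1 / real_of_int \<bar>m\<bar>) = harm (nat N)"
    unfolding harm_def
    by (rule sum.reindex_bij_witness[of _ int nat]) (auto simp: divide_inverse)
  also have "harm (nat N) \<le> (1 + ln N :: real)"
    using euler_mascheroni_sequence_decreasing[of 1 "nat N"] assms
    by (simp add: harm_expand Suc_le_eq)
  finally show ?thesis by simp
qed

lemma equal_products_factorization:
  fixes a b c d :: "'a :: semiring_gcd"
  assumes "a * b = c * d" "a \<noteq> 0"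
  obtains p q r s where "a = p * q" "b = r * s" "c = p * r" "d = q * s"
proof -
  have "a dvd c * d" using assms(1) by (metis dvd_triv_left)
  then obtain p q where "a = p * q" "p dvd c" "q dvd d" using division_decomp by blast
  moreover from this obtain r s where "c = p * r" "d = q * s" by (auto elim!: dvdE)
  moreover from calculation have "(p * q) * b = (p * q) * (r * s)" using assms(1) by (simp add: mult_ac)
  then have "b = r * s" using assms(2) \<open>a = p * q\<close> by simp
  ultimately show ?thesis using that by blast
qed

definition equal_product_quadruples :: "int \<Rightarrow> (int \<times> int \<times> int \<times> int) set" where
  "equal_product_quadruples N = {(a, b, c, d).
     a \<in> nonzero_ints N \<and> b \<in> nonzero_ints N \<and> c \<in> nonzero_ints N \<and> d \<in> nonzero_ints N \<and>
     a * b = c * d}"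

definition dominated_quadruples :: "int \<Rightarrow> (int \<times> int \<times> int \<times> int) set" where
  "dominated_quadruples N = (SIGMA r:nonzero_ints N.
     nonzero_ints \<bar>r\<bar> \<times> nonzero_ints (N div \<bar>r\<bar>) \<times> nonzero_ints (N div \<bar>r\<bar>))"

lemma finite_dominated_quadruples: "finite (dominated_quadruples N)"
  unfolding dominated_quadruples_def
  by (intro finite_SigmaI finite_cartesian_product finite_nonzero_ints)

lemma card_dominated_quadruples_le:
  fixes N :: int
  assumes "N \<ge> 1"
  shows "real (card (dominated_quadruples N)) \<le> 16 * N\<^sup>2 * (1 + ln N)"
proof -
  have "real (card (dominated_quadruples N)) =
      (\<Sum>r\<in>nonzero_ints N. real (card (nonzero_ints \<bar>r\<bar>)) * (real (card (nonzero_ints (N div \<bar>r\<bar>))))\<^sup>2)"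
    unfolding dominated_quadruples_def
    by (subst card_SigmaI) (auto simp: finite_nonzero_ints card_cartesian_product power2_eq_square)
  also have "\<dots> \<le> (\<Sum>r\<in>nonzero_ints N. 8 * N\<^sup>2 * (1 / real_of_int \<bar>r\<bar>))"
  proof (rule sum_mono)
    fix r assume "r \<in> nonzero_ints N"
    then have r_pos: "\<bar>r\<bar> > 0" by (simp add: nonzero_ints_def)
    then have "N div \<bar>r\<bar> \<ge> 0" using assms by (simp add: pos_imp_zdiv_nonneg_iff)
    have "real (card (nonzero_ints \<bar>r\<bar>)) * (real (card (nonzero_ints (N div \<bar>r\<bar>))))\<^sup>2 =
        2 * \<bar>r\<bar> * (2 * real_of_int (N div \<bar>r\<bar>))\<^sup>2"
      using \<open>N div \<bar>r\<bar> \<ge> 0\<close> by (simp add: card_nonzero_ints)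
    also have "\<dots> \<le> 2 * \<bar>r\<bar> * (2 * (N / \<bar>r\<bar>))\<^sup>2"
      using \<open>N div \<bar>r\<bar> \<ge> 0\<close> real_of_int_div4[of N "\<bar>r\<bar>"]
      by (intro mult_left_mono power_mono) auto
    also have "\<dots> = 8 * N\<^sup>2 * (1 / real_of_int \<bar>r\<bar>)"
      using r_pos by (simp add: power2_eq_square divide_simps)
    finally show "real (card (nonzero_ints \<bar>r\<bar>)) * (real (card (nonzero_ints (N div \<bar>r\<bar>))))\<^sup>2 \<le>
      8 * N\<^sup>2 * (1 / real_of_int \<bar>r\<bar>)" .
  qed
  also have "\<dots> = 8 * N\<^sup>2 * (\<Sum>r\<in>nonzero_ints N. 1 / real_of_int \<bar>r\<bar>)"
    by (simp add: sum_distrib_left)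
  also have "\<dots> \<le> 8 * N\<^sup>2 * (2 * (1 + ln N))"
    using sum_inverse_nonzero_ints_le[OF assms] by (intro mult_left_mono) auto
  finally show ?thesis by (simp add: algebra_simps)
qed

lemma mem_dominated_quadruples:
  assumes "r \<in> nonzero_ints N" "q \<noteq> 0" "\<bar>q\<bar> \<le> \<bar>r\<bar>" "p * r \<in> nonzero_ints N" "r * s \<in> nonzero_ints N"
  shows "(r, q, p, s) \<in> dominated_quadruples N"
proof -
  have factor: "m \<in> nonzero_ints (N div \<bar>r\<bar>)" if "m * r \<in> nonzero_ints N" for m
  proof -
    have "\<bar>m\<bar> * \<bar>r\<bar> \<le> N" "m \<noteq> 0" using that by (auto simp: nonzero_ints_def abs_mult[symmetric])
    then have "\<bar>m\<bar> \<le> N div \<bar>r\<bar>"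
      using assms(1) zdiv_mono1[of "\<bar>m\<bar> * \<bar>r\<bar>" N "\<bar>r\<bar>"] by (simp add: nonzero_ints_def)
    then show ?thesis using \<open>m \<noteq> 0\<close> by (auto simp: nonzero_ints_def)
  qed
  have "q \<in> nonzero_ints \<bar>r\<bar>" using assms(2,3) by (auto simp: nonzero_ints_def)
  moreover have "p \<in> nonzero_ints (N div \<bar>r\<bar>)" "s \<in> nonzero_ints (N div \<bar>r\<bar>)"
    using factor[of p] factor[of s] assms(4,5) by (simp_all add: mult.commute)
  ultimately show ?thesis using assms(1) by (simp add: dominated_quadruples_def)
qed

lemma nonzero_ints_mult_leftD:
  assumes "m * n \<in> nonzero_ints N"
  shows "m \<in> nonzero_ints N"
proof -
  have "\<bar>m\<bar> * 1 \<le> \<bar>m\<bar> * \<bar>n\<bar>" using assms by (intro mult_left_mono) (auto simp: nonzero_ints_def)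
  then show ?thesis using assms by (auto simp: nonzero_ints_def abs_mult[symmetric])
qed

text \<open>A solution of \<open>a b = c d\<close> has the form \<open>(p q) (r s) = (p r) (q s)\<close>, and exchanging \<open>c\<close> and \<open>d\<close>
  exchanges \<open>q\<close> and \<open>r\<close>, so half of the solutions have \<open>|q| \<le> |r|\<close>.\<close>

lemma card_equal_product_quadruples_le:
  fixes N :: int
  assumes "N \<ge> 1"
  shows "real (card (equal_product_quadruples N)) \<le> 32 * N\<^sup>2 * (1 + ln N)"
proof -
  let ?W = "dominated_quadruples N"
  define f f' :: "int \<times> int \<times> int \<times> int \<Rightarrow> int \<times> int \<times> int \<times> int"
    where "f = (\<lambda>(r, q, p, s). (p * q, r * s, p * r, q * s))"
      and "f' = (\<lambda>(q, r, p, s). (p * q, r * s, p * r, q * s))"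
  have "equal_product_quadruples N \<subseteq> f ` ?W \<union> f' ` ?W"
  proof
    fix z assume "z \<in> equal_product_quadruples N"
    then obtain a b c d where z_eq: "z = (a, b, c, d)" and products: "a * b = c * d"
      and mem: "a \<in> nonzero_ints N" "b \<in> nonzero_ints N" "c \<in> nonzero_ints N" "d \<in> nonzero_ints N"
      by (auto simp: equal_product_quadruples_def)
    have "a \<noteq> 0" using mem(1) by (simp add: nonzero_ints_def)
    with products obtain p q r s where factors: "a = p * q" "b = r * s" "c = p * r" "d = q * s"
      by (rule equal_products_factorization)
    have "q \<in> nonzero_ints N" "r \<in> nonzero_ints N"
      using mem nonzero_ints_mult_leftD unfolding factors by blast+
    moreover have "q \<noteq> 0" "r \<noteq> 0" using calculation by (auto simp: nonzero_ints_def)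
    ultimately have "(r, q, p, s) \<in> ?W \<or> (q, r, p, s) \<in> ?W"
      using mem unfolding factors by (metis mem_dominated_quadruples linorder_linear)
    moreover have "z = f (r, q, p, s)" "z = f' (q, r, p, s)"
      by (simp_all add: z_eq factors f_def f'_def)
    ultimately show "z \<in> f ` ?W \<union> f' ` ?W" by blast
  qed
  then have "card (equal_product_quadruples N) \<le> card (f ` ?W \<union> f' ` ?W)"
    by (intro card_mono) (simp_all add: finite_dominated_quadruples)
  also have "\<dots> \<le> card (f ` ?W) + card (f' ` ?W)" by (rule card_Un_le)
  also have "\<dots> \<le> card ?W + card ?W"
    by (intro add_mono card_image_le finite_dominated_quadruples)
  finally show ?thesis using card_dominated_quadruples_le[OF assms] by linarith
qed

lemma finite_equal_product_quadruples: "finite (equal_product_quadruples N)"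
  by (rule finite_subset[of _ "{-N..N} \<times> {-N..N} \<times> {-N..N} \<times> {-N..N}"])
    (auto simp: equal_product_quadruples_def nonzero_ints_def)

definition equal_norm_pairs :: "int \<Rightarrow> (int \<times> int) set \<Rightarrow> ((int \<times> int) \<times> (int \<times> int)) set" where
  "equal_norm_pairs a A = {(p, p') \<in> A \<times> A. norm_form a p = norm_form a p'}"

lemma finite_equal_norm_pairs: "finite A \<Longrightarrow> finite (equal_norm_pairs a A)"
  by (rule finite_subset[of _ "A \<times> A"]) (auto simp: equal_norm_pairs_def)

lemma equal_norm_pairs_mono: "A \<subseteq> B \<Longrightarrow> equal_norm_pairs a A \<subseteq> equal_norm_pairs a B"
  by (auto simp: equal_norm_pairs_def)

lemma norm_form_eq_iff:
  "norm_form a (x, y) = norm_form a (x', y') \<longleftrightarrow> (x - x') * (x + x') = (y - y') * (a * (y + y'))"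
  by (auto simp: power2_eq_square algebra_simps)

lemma card_equal_norm_pairs_distinct_le:
  fixes a S :: int
  assumes "a \<noteq> 0"
  shows "card {((x, y), (x', y')) \<in> equal_norm_pairs a ({1..S} \<times> {1..S}). x \<noteq> x' \<and> y \<noteq> y'} \<le>
    card (equal_product_quadruples (2 * \<bar>a\<bar> * S))" (is "card ?Z \<le> _")
proof (rule card_inj_on_le)
  define N where "N = 2 * \<bar>a\<bar> * S"
  define \<phi> :: "(int \<times> int) \<times> (int \<times> int) \<Rightarrow> int \<times> int \<times> int \<times> int"
    where "\<phi> = (\<lambda>((x, y), (x', y')). (x - x', x + x', y - y', a * (y + y')))"
  show "inj_on \<phi> ?Z"
    using assms by (auto simp: inj_on_def \<phi>_def)
  show "\<phi> ` ?Z \<subseteq> equal_product_quadruples (2 * \<bar>a\<bar> * S)"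
    unfolding N_def[symmetric]
  proof
    fix r assume "r \<in> \<phi> ` ?Z"
    then obtain x y x' y' where r_eq: "r = (x - x', x + x', y - y', a * (y + y'))"
      and products: "(x - x') * (x + x') = (y - y') * (a * (y + y'))"
      and distinct: "x \<noteq> x'" "y \<noteq> y'"
      and bounds: "x \<in> {1..S}" "y \<in> {1..S}" "x' \<in> {1..S}" "y' \<in> {1..S}"
      by (auto simp: \<phi>_def equal_norm_pairs_def norm_form_eq_iff simp del: norm_form_Pair)
    have "1 * (2 * S) \<le> \<bar>a\<bar> * (2 * S)"
      using assms bounds by (intro mult_right_mono) auto
    then have "2 * S \<le> N" by (simp add: N_def)
    then have "x - x' \<in> nonzero_ints N" "x + x' \<in> nonzero_ints N" "y - y' \<in> nonzero_ints N"
      using bounds distinct by (auto simp: nonzero_ints_def)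
    moreover have "\<bar>a * (y + y')\<bar> \<le> \<bar>a\<bar> * (2 * S)"
      unfolding abs_mult using bounds by (intro mult_left_mono) auto
    then have "a * (y + y') \<in> nonzero_ints N"
      using bounds assms by (auto simp: nonzero_ints_def N_def)
    ultimately show "r \<in> equal_product_quadruples N"
      using products by (simp add: r_eq equal_product_quadruples_def)
  qed
qed (rule finite_equal_product_quadruples)

lemma card_equal_norm_pairs_le:
  fixes a S :: int
  assumes "a \<noteq> 0" "S \<ge> 1"
  shows "real (card (equal_norm_pairs a ({1..S} \<times> {1..S})))
    \<le> S\<^sup>2 + 128 * a\<^sup>2 * S\<^sup>2 * (1 + ln (2 * \<bar>a\<bar> * S))"
proof -
  let ?A = "{1..S} \<times> {1..S}"
  let ?D = "(\<lambda>p. (p, p)) ` ?A"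
  let ?Z = "{((x, y), (x', y')) \<in> equal_norm_pairs a ?A. x \<noteq> x' \<and> y \<noteq> y'}"
  define N where "N = 2 * \<bar>a\<bar> * S"
  have "N > 0" using assms by (simp add: N_def)
  then have "N \<ge> 1" by simp
  have "equal_norm_pairs a ?A \<subseteq> ?D \<union> ?Z"
    using assms(1) by (auto simp: equal_norm_pairs_def power2_eq_iff)
  moreover have "finite (?D \<union> ?Z)"
    using finite_subset[OF _ finite_equal_norm_pairs[of ?A a], of ?Z] by auto
  ultimately have "card (equal_norm_pairs a ?A) \<le> card (?D \<union> ?Z)" by (rule card_mono[rotated])
  also have "\<dots> \<le> card ?D + card ?Z" by (rule card_Un_le)
  also have "\<dots> \<le> card ?A + card (equal_product_quadruples N)"
    unfolding N_def
    by (intro add_mono card_image_le card_equal_norm_pairs_distinct_le assms) simp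
  also have "real \<dots> \<le> S\<^sup>2 + 32 * N\<^sup>2 * (1 + ln N)"
    using card_equal_product_quadruples_le[OF \<open>N \<ge> 1\<close>] assms(2)
    by (simp add: card_cartesian_product power2_eq_square)
  finally show ?thesis by (simp add: N_def power_mult_distrib)
qed

subsection \<open>Polynomials with coefficients in a given set\<close>

definition poly_box :: "nat \<Rightarrow> 'a :: zero set \<Rightarrow> 'a poly set" where
  "poly_box n A = {P. (\<forall>i<n. coeff P i \<in> A) \<and> (\<forall>i\<ge>n. coeff P i = 0)}"

lemma poly_box_0: "poly_box 0 A = {0}"
  by (auto simp: poly_box_def poly_eq_iff)

lemma pCons_mem_poly_box_Suc_iff: "pCons c P \<in> poly_box (Suc n) A \<longleftrightarrow> c \<in> A \<and> P \<in> poly_box n A"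
  unfolding poly_box_def by (force simp: coeff_pCons split: nat.splits)

lemma poly_box_Suc: "poly_box (Suc n) A = (\<lambda>(P, c). pCons c P) ` (poly_box n A \<times> A)"
proof -
  have "P \<in> (\<lambda>(P, c). pCons c P) ` (poly_box n A \<times> A)" if "P \<in> poly_box (Suc n) A" for P
    using that by (cases P) (auto simp: pCons_mem_poly_box_Suc_iff)
  then show ?thesis by (auto simp: pCons_mem_poly_box_Suc_iff)
qed

lemma inj_pCons: "inj_on (\<lambda>(P, c). pCons c P) A"
  by (auto simp: inj_on_def)

lemma finite_poly_box: "finite A \<Longrightarrow> finite (poly_box n A)"
  by (induction n) (simp_all add: poly_box_0 poly_box_Suc)

lemma card_poly_box: "card (poly_box n A) = card A ^ n"
  by (induction n) (simp_all add: poly_box_0 poly_box_Suc card_image inj_pCons card_cartesian_product)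

lemma sum_poly_box_Suc:
  "(\<Sum>P\<in>poly_box (Suc n) A. f P) = (\<Sum>P\<in>poly_box n A. \<Sum>c\<in>A. f (pCons c P))"
  unfolding poly_box_Suc
  by (subst sum.reindex[OF inj_pCons]) (simp add: sum.cartesian_product case_prod_unfold)

lemma cong_poly:
  fixes x y q :: int
  assumes "[x = y] (mod q)"
  shows "[poly P x = poly P y] (mod q)"
  by (induction P) (simp_all add: cong_add cong_mult assms)

text \<open>The value at \<open>t\<close> determines the constant coefficient modulo \<open>t\<close>; given that coefficient,
  it determines the value at \<open>t\<close> of the polynomial formed by the other ones.\<close>

lemma card_poly_box_fixed_value_le:
  fixes h l t n :: int
  assumes "t > 0" "h \<ge> 0"
  shows "real (card {P \<in> poly_box (Suc d) {l..<l + h}. poly P t = n}) \<le> (h / t + 1) ^ d"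
proof (induction d arbitrary: n)
  case 0
  have "{P \<in> poly_box (Suc 0) {l..<l + h}. poly P t = n} \<subseteq> {[:n:]}"
    by (auto simp: poly_box_Suc poly_box_0)
  then have "card {P \<in> poly_box (Suc 0) {l..<l + h}. poly P t = n} \<le> card {[:n:]}"
    by (rule card_mono[rotated]) simp
  then show ?case by simp
next
  case (Suc d)
  let ?A = "\<lambda>d n. {P \<in> poly_box (Suc d) {l..<l + h}. poly P t = n}"
  have finite_A: "finite (?A d n)" for d n by (simp add: finite_poly_box)
  have "real (card (?A (Suc d) n)) \<le> (h / t + 1) * (h / t + 1) ^ d"
  proof (rule card_le_congruent_image_times_fibre[where f = "\<lambda>P. coeff P 0" and q = t])
    fix P Q assume PQ: "P \<in> ?A (Suc d) n" "Q \<in> ?A (Suc d) n"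
    show "[coeff P 0 = coeff Q 0] (mod t)"
      using PQ cong_poly[of 0 t t P] cong_poly[of 0 t t Q]
      by (auto simp: poly_0_coeff_0 cong_0_iff cong_sym_eq[of 0] intro: cong_trans cong_sym)
    show "real_of_int (coeff P 0 - coeff Q 0) \<le> h"
    proof -
      have "coeff P 0 \<in> {l..<l + h}" "coeff Q 0 \<in> {l..<l + h}" using PQ by (auto simp: poly_box_def)
      then show ?thesis by simp
    qed
  next
    fix c
    have "{P \<in> ?A (Suc d) n. coeff P 0 = c} \<subseteq> pCons c ` ?A d ((n - c) div t)"
      using \<open>t > 0\<close> by (force simp: poly_box_Suc[of "Suc d"])
    then have "card {P \<in> ?A (Suc d) n. coeff P 0 = c} \<le> card (?A d ((n - c) div t))"
      by (rule surj_card_le[OF finite_A])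
    then show "real (card {P \<in> ?A (Suc d) n. coeff P 0 = c}) \<le> (h / t + 1) ^ d"
      using Suc.IH[of "(n - c) div t"] by linarith
  qed (use assms finite_A in auto)
  then show ?case by simp
qed

lemma degree_poly_box:
  assumes "P \<in> poly_box (Suc d) A" "0 \<notin> A"
  shows "degree P = d"
proof (rule antisym)
  show "degree P \<le> d" using assms(1) by (intro degree_le) (auto simp: poly_box_def)
  have "coeff P d \<in> A" using assms(1) by (simp add: poly_box_def)
  then show "d \<le> degree P" using assms(2) by (intro le_degree) auto
qed

lemma poly_eq_poly_shift_2:
  fixes t :: "'a :: comm_ring_1"
  shows "poly P t = coeff P 0 + coeff P 1 * t + t\<^sup>2 * poly (poly_shift 2 P) t"
proof -
  obtain b c Q where P_eq: "P = pCons b (pCons c Q)" by (metis pCons_cases)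
  have "poly_shift 2 P = Q"
    by (simp add: P_eq poly_eq_iff coeff_poly_shift numeral_2_eq_2)
  then show ?thesis by (simp add: P_eq power2_eq_square algebra_simps)
qed

lemma poly_diff_same_shift:
  fixes t :: "'a :: comm_ring_1"
  assumes "poly_shift 2 P = poly_shift 2 R"
  shows "poly P t - poly R t = (coeff P 0 - coeff R 0) + (coeff P 1 - coeff R 1) * t"
  using poly_eq_poly_shift_2[of P t] poly_eq_poly_shift_2[of R t] assms by (simp add: algebra_simps)

lemma poly_eqI_same_shift:
  fixes t s :: "'a :: idom"
  assumes "poly_shift 2 P = poly_shift 2 R" "t \<noteq> s" "poly P t = poly R t" "poly P s = poly R s"
  shows "P = R"
proof -
  have at_t: "(coeff P 0 - coeff R 0) + (coeff P 1 - coeff R 1) * t = 0"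
    and at_s: "(coeff P 0 - coeff R 0) + (coeff P 1 - coeff R 1) * s = 0"
    using poly_diff_same_shift[OF assms(1)] assms(3,4) by (metis diff_self)+
  have "(coeff P 1 - coeff R 1) * (t - s) =
      ((coeff P 0 - coeff R 0) + (coeff P 1 - coeff R 1) * t) -
      ((coeff P 0 - coeff R 0) + (coeff P 1 - coeff R 1) * s)"
    by (simp add: algebra_simps)
  then have "(coeff P 1 - coeff R 1) * (t - s) = 0" unfolding at_t at_s by simp
  then have "coeff P 1 = coeff R 1" using assms(2) by simp
  moreover from this have "coeff P 0 = coeff R 0" using at_t by simp
  moreover have "coeff P (i + 2) = coeff R (i + 2)" for i
    using assms(1) by (metis coeff_poly_shift)
  ultimately show ?thesis
    by (metis poly_eqI One_nat_def add_2_eq_Suc' not0_implies_Suc)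
qed

subsection \<open>Heights and proportions\<close>

lemma abs_coeff_le_height: "\<bar>coeff P i\<bar> \<le> height P"
proof (cases "i \<le> degree P")
  case True
  then show ?thesis unfolding height_def by (intro Max_ge) auto
next
  case False
  have "0 \<le> \<bar>coeff P 0\<bar>" by simp
  also have "\<dots> \<le> height P" unfolding height_def by (intro Max_ge) auto
  finally show ?thesis using False by (simp add: coeff_eq_0)
qed

lemma height_le_iff: "height P \<le> n \<longleftrightarrow> (\<forall>i\<le>degree P. \<bar>coeff P i\<bar> \<le> n)"
  unfolding height_def by (subst Max_le_iff) auto

lemma card_polys_of_height_at_most_le: "card (polys_of_height_at_most d H) \<le> (2 * H + 1) ^ Suc d"
proof -
  have "polys_of_height_at_most d H \<subseteq> poly_box (Suc d) {- int H..int H}"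
  proof
    fix P assume "P \<in> polys_of_height_at_most d H"
    then have "degree P = d" "height P \<le> int H" by (auto simp: polys_of_height_at_most_def)
    then have "\<bar>coeff P i\<bar> \<le> int H" for i using abs_coeff_le_height[of P i] by linarith
    then show "P \<in> poly_box (Suc d) {- int H..int H}"
      using \<open>degree P = d\<close> by (auto simp: poly_box_def abs_le_iff coeff_eq_0 minus_le_iff)
  qed
  then have "card (polys_of_height_at_most d H) \<le> card (poly_box (Suc d) {- int H..int H})"
    by (intro card_mono finite_poly_box) simp
  also have "\<dots> = (2 * H + 1) ^ Suc d"
  proof -
    have "card {- int H..int H} = 2 * H + 1" by simp
    then show ?thesis by (simp only: card_poly_box)
  qed
  finally show ?thesis .
qed

lemma positive_proportionI:
  assumes "c > 0"
    and "\<forall>\<^sub>F H in sequentially. c * real H ^ Suc d \<le> real (card {P \<in> polys_of_height_at_most d H. Q P})"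
  shows "positive_proportion d Q"
proof -
  let ?N = "\<lambda>H. card {P \<in> polys_of_height_at_most d H. Q P}"
    and ?D = "\<lambda>H. card (polys_of_height_at_most d H)"
  have "\<forall>\<^sub>F H in sequentially. ereal (c / 3 ^ Suc d) \<le> ereal (real (?N H) / real (?D H))"
    using assms(2) eventually_ge_at_top[of 1]
  proof eventually_elim
    case (elim H)
    have "0 < c * real H ^ Suc d" using \<open>c > 0\<close> elim(2) by simp
    then have "0 < real (?N H)" using elim(1) by linarith
    moreover have "?N H \<le> ?D H" using finite_polys_of_height_at_most by (intro card_mono) auto
    ultimately have "0 < ?D H" by simp
    have "?D H \<le> (2 * H + 1) ^ Suc d" by (rule card_polys_of_height_at_most_le)
    also have "\<dots> \<le> (3 * H) ^ Suc d" using elim(2) by (intro power_mono) auto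
    finally have "real (?D H) \<le> real ((3 * H) ^ Suc d)" by (simp only: of_nat_le_iff)
    then have "c / 3 ^ Suc d * real (?D H) \<le> c / 3 ^ Suc d * real ((3 * H) ^ Suc d)"
      using \<open>c > 0\<close> by (intro mult_left_mono) auto
    also have "\<dots> = c * real H ^ Suc d" by (simp add: power_mult_distrib)
    also have "\<dots> \<le> real (?N H)" by (rule elim(1))
    finally show ?case using \<open>0 < ?D H\<close> by (simp add: pos_le_divide_eq)
  qed
  then have "ereal (c / 3 ^ Suc d) \<le> liminf (\<lambda>H. ereal (real (?N H) / real (?D H)))"
    by (rule Liminf_bounded)
  moreover have "0 < ereal (c / 3 ^ Suc d)" using \<open>c > 0\<close> by simp
  ultimately show ?thesis unfolding positive_proportion_def by (rule order_less_le_trans[rotated])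
qed

subsection \<open>A family of polynomials with many representations\<close>

text \<open>The abscissae of the representations of \<open>P(t)\<close> counted below satisfy
  \<open>x\<^sup>2 \<le> square_bound d * h * T ^ d\<close>.\<close>

definition square_bound :: "nat \<Rightarrow> int" where
  "square_bound d = (int d + 1) * 2 ^ (d + 1) + 1"

lemma two_power_le_square_bound: "square_bound d \<ge> 2 ^ d"
proof -
  have "1 * 2 ^ d \<le> (2 * (int d + 1)) * 2 ^ d" by (intro mult_right_mono) auto
  then show ?thesis by (simp add: square_bound_def algebra_simps)
qed

lemma square_bound_ge_1: "square_bound d \<ge> 1"
  by (simp add: square_bound_def)

text \<open>Here \<open>41088 = 128 * 321\<close>: on average over the family, the second moment is at most
  \<open>321 a\<^sup>2 K\<^sup>2 T\<^sup>2\<close>, and the squared mean is at least \<open>T\<^sup>2 / (128 |a| K)\<close>, where \<open>K = square_bound d\<close>.\<close>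

definition represented_const :: "int \<Rightarrow> nat \<Rightarrow> real" where
  "represented_const a d = 41088 * \<bar>a\<bar> ^ 3 * square_bound d ^ 3"

lemma represented_const_pos: "a \<noteq> 0 \<Longrightarrow> represented_const a d > 0"
  using square_bound_ge_1[of d] by (simp add: represented_const_def)

locale conic_family =
  fixes a h T :: int and d :: nat
  assumes a_nonzero: "a \<noteq> 0" and d_pos: "d > 0" and T_ge_1: "T \<ge> 1"
    and h_large: "16 * a\<^sup>2 * square_bound d * T ^ (d + 2) \<le> h"
    and ln_h_le: "ln h \<le> T"
begin

abbreviation K :: int where "K \<equiv> square_bound d"
abbreviation coeff_range :: "int set" where "coeff_range \<equiv> {h..<2 * h}"
abbreviation polys :: "int poly set" where "polys \<equiv> poly_box (Suc d) coeff_range"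
abbreviation points :: "int set" where "points \<equiv> {T..<2 * T}"

definition value_min :: real where "value_min = h * T ^ d"
definition x_min :: real where "x_min = sqrt (value_min / 2)"
definition x_max :: real where "x_max = sqrt (K * value_min)"
definition y_max :: int where "y_max = \<lfloor>sqrt (value_min / (2 * \<bar>a\<bar>))\<rfloor>"

definition rect :: "(int \<times> int) set" where
  "rect = {(x, y). x_min \<le> x \<and> x \<le> x_max \<and> y \<in> {1..y_max}}"

definition reps :: "int poly \<Rightarrow> int \<Rightarrow> (int \<times> int) set" where
  "reps P t = {p \<in> rect. norm_form a p = poly P t}"

lemma abs_a_ge_1: "\<bar>a\<bar> \<ge> 1"
  using a_nonzero by auto

lemma mult_T_power_le_h:
  assumes "m \<le> 16 * a\<^sup>2 * K" "k \<le> d + 2"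
  shows "real_of_int m * T ^ k \<le> h"
proof -
  have "m * T ^ k \<le> (16 * a\<^sup>2 * K) * T ^ (d + 2)"
    using assms T_ge_1 square_bound_ge_1[of d] by (intro mult_mono power_increasing) auto
  also have "\<dots> \<le> h" using h_large by simp
  finally show ?thesis by (simp only: of_int_le_iff flip: of_int_power of_int_mult)
qed

lemma abs_a_le_a_sq_K: "\<bar>a\<bar> \<le> a\<^sup>2 * K"
proof -
  have "\<bar>a\<bar> * 1 \<le> \<bar>a\<bar> * (\<bar>a\<bar> * K)"
    using abs_a_ge_1 square_bound_ge_1[of d] mult_mono[of 1 "\<bar>a\<bar>" 1 K] by (intro mult_left_mono) auto
  then show ?thesis by (simp add: power2_eq_square mult.assoc[symmetric])
qed

lemma small_mult_T_power_le_h: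
  assumes "m \<le> 16 * \<bar>a\<bar>" "k \<le> d + 2"
  shows "real_of_int m * T ^ k \<le> h"
  using assms abs_a_le_a_sq_K by (intro mult_T_power_le_h) linarith+

lemma h_pos: "h > 0"
  using small_mult_T_power_le_h[of 1 0] abs_a_ge_1 by simp

lemma h_le_value_min: "h \<le> value_min"
proof -
  have "real_of_int h * 1 \<le> real_of_int h * real_of_int (T ^ d)"
    using h_pos T_ge_1 by (intro mult_left_mono) (simp_all del: of_int_power)
  then show ?thesis by (simp add: value_min_def)
qed

lemma value_min_pos: "value_min > 0"
  using h_le_value_min h_pos by linarith

lemma x_min_pos: "x_min > 0" and x_min_sq: "x_min\<^sup>2 = value_min / 2"
  using value_min_pos by (auto simp: x_min_def)

lemma x_max_pos: "x_max > 0" and x_max_sq: "x_max\<^sup>2 = K * value_min"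
  using value_min_pos square_bound_ge_1[of d] by (auto simp: x_max_def)

lemma T_le_x_min: "T \<le> x_min"
proof -
  have "2 * (real_of_int T)\<^sup>2 \<le> h" using small_mult_T_power_le_h[of 2 2] abs_a_ge_1 by simp
  then have "(real_of_int T)\<^sup>2 \<le> value_min / 2" using h_le_value_min by linarith
  then show ?thesis unfolding x_min_def by (rule real_le_rsqrt)
qed

lemma T_x_min_le_h: "2 * T * x_min \<le> h"
proof (rule power2_le_imp_le)
  have "(2 * T * x_min)\<^sup>2 = h * (2 * real_of_int (T ^ (d + 2)))"
    by (simp only: power_mult_distrib x_min_sq) (simp add: value_min_def power_add power2_eq_square)
  also have "\<dots> \<le> h * real_of_int h"
    using small_mult_T_power_le_h[of 2 "d + 2"] abs_a_ge_1 h_pos by (intro mult_left_mono) auto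
  finally show "(2 * T * x_min)\<^sup>2 \<le> (real_of_int h)\<^sup>2" by (simp add: power2_eq_square)
qed (use h_pos in auto)

lemma a_x_max_le_h: "4 * \<bar>a\<bar> * x_max \<le> h"
proof (rule power2_le_imp_le)
  have "(4 * \<bar>a\<bar> * x_max)\<^sup>2 = h * (real_of_int (16 * a\<^sup>2 * K) * T ^ d)"
    by (simp add: power_mult_distrib x_max_sq value_min_def)
  also have "\<dots> \<le> h * real_of_int h"
    using mult_T_power_le_h[of "16 * a\<^sup>2 * K" d] h_pos by (intro mult_left_mono) auto
  finally show "(4 * \<bar>a\<bar> * x_max)\<^sup>2 \<le> (real_of_int h)\<^sup>2" by (simp add: power2_eq_square)
qed (use h_pos in auto)

lemma x_max_le_h: "4 * x_max \<le> h"
proof -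
  have "4 * x_max * 1 \<le> 4 * x_max * \<bar>a\<bar>" using abs_a_ge_1 x_max_pos by (intro mult_left_mono) auto
  then show ?thesis using a_x_max_le_h by (simp add: mult_ac)
qed

lemma x_min_le_x_max: "x_min \<le> x_max"
proof -
  have "1 * value_min \<le> K * value_min"
    using value_min_pos square_bound_ge_1[of d] by (intro mult_right_mono) auto
  then show ?thesis
    using value_min_pos unfolding x_min_def x_max_def by (intro real_sqrt_le_mono) linarith
qed

lemma y_max_le_x_min: "y_max \<le> x_min"
proof -
  have "y_max \<le> sqrt (value_min / (2 * \<bar>a\<bar>))" by (simp add: y_max_def)
  also have "\<dots> \<le> x_min"
    unfolding x_min_def using value_min_pos abs_a_ge_1
    by (intro real_sqrt_le_mono divide_left_mono) auto
  finally show ?thesis .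
qed

lemma y_max_ge: "x_max / (2 * sqrt (2 * \<bar>a\<bar> * K)) \<le> y_max"
proof -
  define s where "s = sqrt (value_min / (2 * \<bar>a\<bar>))"
  have "2 * real_of_int \<bar>a\<bar> \<le> h"
    using small_mult_T_power_le_h[of "2 * \<bar>a\<bar>" 0] by simp
  then have "2 * real_of_int \<bar>a\<bar> \<le> value_min" using h_le_value_min by linarith
  then have "s \<ge> 1" using abs_a_ge_1 by (simp add: s_def field_simps)
  then have "\<lfloor>s\<rfloor> \<ge> 1" by simp
  then have "s / 2 \<le> y_max" unfolding y_max_def s_def[symmetric] by linarith
  moreover have "s = x_max / sqrt (2 * \<bar>a\<bar> * K)"
    using abs_a_ge_1 square_bound_ge_1[of d]
    by (simp add: s_def x_max_def real_sqrt_divide[symmetric] real_sqrt_mult[symmetric] del: real_sqrt_mult)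
  ultimately show ?thesis by simp
qed

lemma y_max_nonneg: "y_max \<ge> 0"
  using value_min_pos by (simp add: y_max_def)

lemma abs_a_y_sq_le:
  assumes "y \<in> {1..y_max}"
  shows "\<bar>real_of_int (a * y\<^sup>2)\<bar> \<le> value_min / 2"
proof -
  have "real_of_int y \<le> sqrt (value_min / (2 * \<bar>a\<bar>))"
    using assms by (auto simp: y_max_def le_floor_iff)
  then have "(real_of_int y)\<^sup>2 \<le> (sqrt (value_min / (2 * \<bar>a\<bar>)))\<^sup>2"
    using assms by (intro power_mono) auto
  also have "\<dots> = value_min / (2 * \<bar>a\<bar>)" using value_min_pos by simp
  finally show ?thesis using abs_a_ge_1 by (simp add: abs_mult field_simps)
qed

lemma finite_polys: "finite polys"
  by (simp add: finite_poly_box)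

lemma finite_rect: "finite rect"
  by (rule finite_subset[of _ "{\<lfloor>x_min\<rfloor>..\<lfloor>x_max\<rfloor>} \<times> {1..y_max}"])
    (auto simp: rect_def le_floor_iff floor_le_iff)

lemma finite_reps: "finite (reps P t)"
  by (simp add: reps_def finite_rect)

lemma poly_eq_sum_coeffs:
  assumes "P \<in> polys"
  shows "poly P t = (\<Sum>i\<le>d. coeff P i * t ^ i)"
  using degree_poly_box[OF assms] h_pos by (simp add: poly_altdef)

lemma coeff_polys:
  assumes "P \<in> polys" "i \<le> d"
  shows "h \<le> coeff P i" "coeff P i < 2 * h" "0 \<le> coeff P i"
proof -
  show "h \<le> coeff P i" "coeff P i < 2 * h" using assms by (auto simp: poly_box_def)
  then show "0 \<le> coeff P i" using h_pos by linarith
qed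

lemma value_min_le_poly:
  assumes "P \<in> polys" "t \<in> points"
  shows "value_min \<le> poly P t"
proof -
  have "h * T ^ d \<le> coeff P d * t ^ d"
    using assms coeff_polys[OF assms(1), of d] T_ge_1 h_pos by (intro mult_mono power_mono) auto
  also have "\<dots> = (\<Sum>i\<in>{d}. coeff P i * t ^ i)" by simp
  also have "\<dots> \<le> poly P t"
    unfolding poly_eq_sum_coeffs[OF assms(1)]
    using assms(2) coeff_polys(3)[OF assms(1)] T_ge_1 by (intro sum_mono2) auto
  finally have "real_of_int (h * T ^ d) \<le> poly P t" by (simp only: of_int_le_iff)
  then show ?thesis by (simp add: value_min_def)
qed

lemma poly_le_value_min:
  assumes "P \<in> polys" "t \<in> points"
  shows "poly P t \<le> (K - 1) * value_min"
proof -
  have "poly P t \<le> (\<Sum>i\<le>d. 2 * h * (2 * T) ^ d)"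
    unfolding poly_eq_sum_coeffs[OF assms(1)]
  proof (intro sum_mono mult_mono)
    fix i assume i: "i \<in> {..d}"
    show "coeff P i \<le> 2 * h" using coeff_polys(2)[OF assms(1), of i] i by simp
    have "t ^ i \<le> (2 * T) ^ i" using assms T_ge_1 by (intro power_mono) auto
    also have "\<dots> \<le> (2 * T) ^ d" using T_ge_1 i by (intro power_increasing) auto
    finally show "t ^ i \<le> (2 * T) ^ d" .
  qed (use assms T_ge_1 h_pos in auto)
  also have "\<dots> = (K - 1) * (h * T ^ d)"
    by (simp add: square_bound_def power_mult_distrib algebra_simps)
  finally have "real_of_int (poly P t) \<le> real_of_int ((K - 1) * (h * T ^ d))"
    by (simp only: of_int_le_iff)
  then show ?thesis by (simp add: value_min_def)
qed

lemma repsI: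
  assumes "P \<in> polys" "t \<in> points" "x > 0" "y \<in> {1..y_max}" "norm_form a (x, y) = poly P t"
  shows "(x, y) \<in> reps P t"
proof -
  have x_sq: "(real_of_int x)\<^sup>2 = real_of_int (poly P t) + real_of_int (a * y\<^sup>2)"
    using assms(5) by (metis add_diff_cancel_right' diff_add_cancel norm_form_Pair of_int_add of_int_power)
  note bounds = value_min_le_poly[OF assms(1,2)] poly_le_value_min[OF assms(1,2)]
    abs_a_y_sq_le[OF assms(4)]
  have "value_min / 2 \<le> (real_of_int x)\<^sup>2" using x_sq bounds by linarith
  then have "x_min \<le> x" unfolding x_min_def using assms(3) by (intro real_le_lsqrt) auto
  moreover have "(real_of_int x)\<^sup>2 \<le> K * value_min"
    using x_sq bounds value_min_pos by (simp add: algebra_simps)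
  then have "x \<le> x_max" unfolding x_max_def by (rule real_le_rsqrt)
  ultimately show ?thesis using assms(4,5) by (simp add: reps_def rect_def)
qed

subsection \<open>The first moment\<close>

lemma sum_card_reps_pCons:
  "(\<Sum>c\<in>coeff_range. card (reps (pCons c Q) t)) =
    card {p \<in> rect. norm_form a p - t * poly Q t \<in> coeff_range}"
proof -
  let ?A = "{p \<in> rect. norm_form a p - t * poly Q t \<in> coeff_range}"
  have "card ?A = (\<Sum>c\<in>coeff_range. card {p \<in> ?A. norm_form a p - t * poly Q t = c})"
    using finite_rect by (intro card_eq_sum_card_fibres) auto
  also have "\<dots> = (\<Sum>c\<in>coeff_range. card (reps (pCons c Q) t))"
    by (intro sum.cong refl arg_cong[of _ _ card]) (auto simp: reps_def)
  finally show ?thesis ..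
qed

lemma card_abscissae_ge:
  assumes Q: "Q \<in> poly_box d coeff_range" and t: "t \<in> points" and y: "y \<in> {1..y_max}"
  defines "w \<equiv> t * poly Q t + a * y\<^sup>2"
  shows "h / (4 * x_max) \<le> real (card {x. x > 0 \<and> h + w \<le> x\<^sup>2 \<and> x\<^sup>2 < 2 * h + w})"
    (is "_ \<le> real (card ?X)")
proof -
  have mem_polys: "pCons c Q \<in> polys" if "c \<in> coeff_range" for c
    using Q that by (simp add: pCons_mem_poly_box_Suc_iff)
  note a_y = abs_a_y_sq_le[OF y]
  have "value_min \<le> real_of_int (h + t * poly Q t)"
    using value_min_le_poly[OF mem_polys t, of h] h_pos by simp
  then have lower: "real_of_int (h + w) > 0"
    using a_y value_min_pos by (simp add: w_def)
  have "real_of_int (2 * h - 1 + t * poly Q t) \<le> (K - 1) * value_min"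
    using poly_le_value_min[OF mem_polys t, of "2 * h - 1"] h_pos by simp
  moreover have "2 \<le> value_min"
    using small_mult_T_power_le_h[of 2 0] abs_a_ge_1 h_le_value_min by simp
  ultimately have upper: "real_of_int (2 * h + w) \<le> x_max\<^sup>2"
    using a_y unfolding x_max_sq w_def by (simp add: algebra_simps)
  have "h / (2 * x_max) - 1 \<le> real (card ?X)"
    using card_squares_in_interval_ge[OF lower _ upper x_max_pos, unfolded of_int_le_iff of_int_less_iff]
      h_pos by simp
  moreover have "1 \<le> h / (4 * x_max)" using x_max_le_h x_max_pos by (simp add: field_simps)
  ultimately show ?thesis by (simp add: field_simps)
qed

lemma sum_card_reps_pCons_ge:
  assumes Q: "Q \<in> poly_box d coeff_range" and t: "t \<in> points"
  shows "y_max * (h / (4 * x_max)) \<le> (\<Sum>c\<in>coeff_range. real (card (reps (pCons c Q) t)))"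
proof -
  define w where "w = (\<lambda>y. t * poly Q t + a * y\<^sup>2)"
  define X where "X = (\<lambda>y. {x. x > 0 \<and> h + w y \<le> x\<^sup>2 \<and> x\<^sup>2 < 2 * h + w y})"
  let ?A = "{p \<in> rect. norm_form a p - t * poly Q t \<in> coeff_range}"
  have mem: "(x, y) \<in> ?A" if "y \<in> {1..y_max}" "x \<in> X y" for x y
  proof -
    let ?c = "norm_form a (x, y) - t * poly Q t"
    have "?c \<in> coeff_range" "x > 0" using that(2) by (auto simp: X_def w_def)
    moreover from this have "pCons ?c Q \<in> polys" using Q by (simp only: pCons_mem_poly_box_Suc_iff)
    then have "(x, y) \<in> reps (pCons ?c Q) t"
      using t \<open>x > 0\<close> that(1) by (rule repsI) simp
    ultimately show ?thesis by (simp add: reps_def)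
  qed
  have finite_X: "finite (X y)" if "y \<in> {1..y_max}" for y
    using mem[OF that] finite_rect by (intro finite_subset[of "X y" "fst ` rect"]) force+
  have "y_max * (h / (4 * x_max)) = (\<Sum>y\<in>{1..y_max}. h / (4 * x_max))"
    using y_max_nonneg by simp
  also have "\<dots> \<le> (\<Sum>y\<in>{1..y_max}. real (card (X y)))"
    unfolding X_def w_def using card_abscissae_ge[OF Q t] by (intro sum_mono)
  also have "\<dots> = real (card (SIGMA y:{1..y_max}. X y))"
    using finite_X by (simp add: card_SigmaI)
  also have "\<dots> \<le> real (card ?A)"
    unfolding of_nat_le_iff using mem finite_rect
    by (intro card_inj_on_le[of prod.swap]) auto
  also have "\<dots> = (\<Sum>c\<in>coeff_range. real (card (reps (pCons c Q) t)))"
    by (simp only: sum_card_reps_pCons flip: of_nat_sum)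
  finally show ?thesis .
qed

lemma first_moment:
  assumes "t \<in> points"
  shows "h ^ (d + 1) / (8 * sqrt (2 * \<bar>a\<bar> * K)) \<le> (\<Sum>P\<in>polys. real (card (reps P t)))"
proof -
  have "h ^ (d + 1) / (8 * sqrt (2 * \<bar>a\<bar> * K)) =
      h ^ d * (x_max / (2 * sqrt (2 * \<bar>a\<bar> * K)) * (h / (4 * x_max)))"
    using x_max_pos by simp
  also have "\<dots> \<le> h ^ d * (y_max * (h / (4 * x_max)))"
    using y_max_ge h_pos x_max_pos by (intro mult_left_mono mult_right_mono) auto
  also have "\<dots> = (\<Sum>Q\<in>poly_box d coeff_range. y_max * (h / (4 * x_max)))"
    using h_pos by (simp add: card_poly_box)
  also have "\<dots> \<le> (\<Sum>Q\<in>poly_box d coeff_range. \<Sum>c\<in>coeff_range. real (card (reps (pCons c Q) t)))"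
    using sum_card_reps_pCons_ge[OF _ assms] by (intro sum_mono)
  also have "\<dots> = (\<Sum>P\<in>polys. real (card (reps P t)))"
    by (rule sum_poly_box_Suc[symmetric])
  finally show ?thesis .
qed

subsection \<open>The second moment\<close>

lemma sum_card_reps_mult:
  assumes "finite F"
  shows "(\<Sum>P\<in>F. card (reps P t) * card (reps P s)) =
    (\<Sum>(p, p')\<in>rect \<times> rect. card {P \<in> F. norm_form a p = poly P t \<and> norm_form a p' = poly P s})"
proof -
  let ?R = "\<lambda>P z. norm_form a (fst z) = poly P t \<and> norm_form a (snd z) = poly P s"
  have "reps P t \<times> reps P s = {z \<in> rect \<times> rect. ?R P z}" for P
    by (auto simp: reps_def)
  then have "(\<Sum>P\<in>F. card (reps P t) * card (reps P s)) = (\<Sum>P\<in>F. card {z \<in> rect \<times> rect. ?R P z})"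
    by (simp flip: card_cartesian_product)
  also have "\<dots> = (\<Sum>z\<in>rect \<times> rect. card {P \<in> F. ?R P z})"
    using assms finite_rect by (intro sum_multicount_gen) auto
  finally show ?thesis by (simp only: case_prod_unfold)
qed

lemma card_polys_fixed_value_le:
  assumes "t \<in> points"
  shows "real (card {P \<in> polys. poly P t = n}) \<le> (2 * h / T) ^ d"
proof -
  have "t > 0" using assms T_ge_1 by auto
  have "real_of_int T \<le> h" using small_mult_T_power_le_h[of 1 1] abs_a_ge_1 by simp
  have "real (card {P \<in> polys. poly P t = n}) \<le> (h / t + 1) ^ d"
    using card_poly_box_fixed_value_le[OF \<open>t > 0\<close>, of h d h n] h_pos by simp
  also have "\<dots> \<le> (2 * h / T) ^ d"
  proof (rule power_mono)
    have "h / t \<le> h / T" using assms h_pos T_ge_1 by (intro divide_left_mono) auto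
    moreover have "1 \<le> h / T" using \<open>real_of_int T \<le> h\<close> T_ge_1 by simp
    ultimately show "h / t + 1 \<le> 2 * h / T" by simp
    show "0 \<le> h / t + 1" using h_pos \<open>t > 0\<close> by simp
  qed
  finally show ?thesis .
qed

lemma card_equal_norm_pairs_rect_le:
  "real (card (equal_norm_pairs a rect)) \<le> 257 * a\<^sup>2 * K * T * value_min"
proof -
  define S where "S = \<lfloor>x_max\<rfloor>"
  have "1 \<le> x_max" using T_le_x_min T_ge_1 x_min_le_x_max by linarith
  then have S_bounds: "S \<ge> 1" "S \<le> x_max" by (auto simp: S_def)
  have "1 \<le> a\<^sup>2" using a_nonzero by (simp add: int_one_le_iff_zero_less)
  have "real_of_int y_max \<le> x_max" using y_max_le_x_min x_min_le_x_max by simp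
  then have "y_max \<le> S" by (simp add: S_def le_floor_iff)
  then have "rect \<subseteq> {1..S} \<times> {1..S}"
    using T_le_x_min T_ge_1 by (auto simp: rect_def S_def le_floor_iff)
  then have "card (equal_norm_pairs a rect) \<le> card (equal_norm_pairs a ({1..S} \<times> {1..S}))"
    by (intro card_mono finite_equal_norm_pairs equal_norm_pairs_mono) auto
  also have "real \<dots> \<le> S\<^sup>2 + 128 * a\<^sup>2 * S\<^sup>2 * (1 + ln (2 * \<bar>a\<bar> * S))"
    using a_nonzero S_bounds(1) by (rule card_equal_norm_pairs_le)
  also have "\<dots> \<le> real_of_int (S\<^sup>2) * (a\<^sup>2 * T) + real_of_int (128 * a\<^sup>2 * S\<^sup>2) * (2 * T)"
  proof (intro add_mono mult_left_mono)
    have "real_of_int (1 * 1) \<le> real_of_int (a\<^sup>2 * T)"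
      unfolding of_int_le_iff using \<open>1 \<le> a\<^sup>2\<close> T_ge_1 by (intro mult_mono) auto
    then show "real_of_int (S\<^sup>2) \<le> real_of_int (S\<^sup>2) * (a\<^sup>2 * T)" by (simp add: mult_le_cancel_left1)
    have "2 * \<bar>a\<bar> * S \<le> 4 * \<bar>a\<bar> * x_max"
      using S_bounds by (simp add: mult.assoc mult_mono)
    also have "\<dots> \<le> h" by (rule a_x_max_le_h)
    finally have "ln (2 * \<bar>a\<bar> * S) \<le> ln h" using S_bounds(1) a_nonzero by (intro ln_mono) auto
    then show "1 + ln (2 * \<bar>a\<bar> * S) \<le> 2 * T" using ln_h_le T_ge_1 by linarith
  qed simp
  also have "\<dots> = real_of_int (257 * a\<^sup>2 * T) * (real_of_int S)\<^sup>2" by (simp add: algebra_simps)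
  also have "\<dots> \<le> real_of_int (257 * a\<^sup>2 * T) * x_max\<^sup>2"
    using S_bounds T_ge_1 by (intro mult_left_mono power_mono) auto
  finally show ?thesis by (simp add: x_max_sq mult_ac)
qed

lemma diagonal_second_moment:
  assumes "t \<in> points"
  shows "(\<Sum>P\<in>polys. real (card (reps P t) * card (reps P t))) \<le>
    257 * 2 ^ d * a\<^sup>2 * K * h ^ (d + 1) * T"
proof -
  let ?N = "\<lambda>p p'. card {P \<in> polys. norm_form a p = poly P t \<and> norm_form a p' = poly P t}"
  have "(\<Sum>P\<in>polys. card (reps P t) * card (reps P t)) = (\<Sum>(p, p')\<in>rect \<times> rect. ?N p p')"
    by (rule sum_card_reps_mult[OF finite_polys])
  also have "\<dots> = (\<Sum>(p, p')\<in>equal_norm_pairs a rect. ?N p p')"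
    using finite_rect by (intro sum.mono_neutral_right)
      (auto simp: equal_norm_pairs_def card_gt_0_iff simp del: norm_form_Pair)
  also have "real \<dots> \<le> real (card (equal_norm_pairs a rect)) * (2 * h / T) ^ d"
    unfolding of_nat_sum
  proof (intro sum_bounded_above)
    fix z assume "z \<in> equal_norm_pairs a rect"
    obtain p p' where z_eq: "z = (p, p')" by (cases z)
    have "?N p p' \<le> card {P \<in> polys. poly P t = norm_form a p}"
      using finite_polys by (intro card_mono) auto
    then show "real (case z of (p, p') \<Rightarrow> ?N p p') \<le> (2 * h / T) ^ d"
      using card_polys_fixed_value_le[OF assms, of "norm_form a p"] by (simp add: z_eq)
  qed
  also have "\<dots> \<le> (257 * a\<^sup>2 * K * T * value_min) * (2 * h / T) ^ d"
    using card_equal_norm_pairs_rect_le h_pos T_ge_1 by (intro mult_right_mono) auto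
  also have "\<dots> = 257 * 2 ^ d * a\<^sup>2 * K * h ^ (d + 1) * T"
    using T_ge_1 by (simp add: value_min_def power_divide power_mult_distrib)
  finally show ?thesis by simp
qed

definition coincidences :: "int poly \<Rightarrow> int \<Rightarrow> int \<Rightarrow> ((int \<times> int) \<times> (int \<times> int)) set" where
  "coincidences Q t s = {(p, p') \<in> rect \<times> rect. \<exists>P\<in>polys. poly_shift 2 P = Q \<and>
     norm_form a p = poly P t \<and> norm_form a p' = poly P s}"

lemma finite_coincidences: "finite (coincidences Q t s)"
  by (rule finite_subset[of _ "rect \<times> rect"]) (auto simp: coincidences_def finite_rect)

lemma second_moment_fixed_shift_le:
  assumes "t \<noteq> s"
  shows "(\<Sum>P | P \<in> polys \<and> poly_shift 2 P = Q. card (reps P t) * card (reps P s)) \<le>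
    card (coincidences Q t s)"
proof -
  let ?F = "{P. P \<in> polys \<and> poly_shift 2 P = Q}"
  let ?N = "\<lambda>p p'. card {P \<in> ?F. norm_form a p = poly P t \<and> norm_form a p' = poly P s}"
  have "(\<Sum>P\<in>?F. card (reps P t) * card (reps P s)) = (\<Sum>(p, p')\<in>rect \<times> rect. ?N p p')"
    using finite_polys by (intro sum_card_reps_mult) simp
  also have "\<dots> = (\<Sum>(p, p')\<in>coincidences Q t s. ?N p p')"
    using finite_rect by (intro sum.mono_neutral_right)
      (auto simp: coincidences_def card_gt_0_iff simp del: norm_form_Pair)
  also have "\<dots> \<le> (\<Sum>z\<in>coincidences Q t s. 1)"
  proof (rule sum_mono)
    fix z assume "z \<in> coincidences Q t s"
    obtain p p' where z_eq: "z = (p, p')" by (cases z)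
    have "?N p p' \<le> 1"
      using finite_polys poly_eqI_same_shift[OF _ assms] by (auto simp: card_le_Suc0_iff_eq)
    then show "(case z of (p, p') \<Rightarrow> ?N p p') \<le> 1" by (simp add: z_eq)
  qed
  finally show ?thesis by simp
qed

lemma abs_coeff_diff_le:
  assumes "P \<in> polys" "R \<in> polys" "i \<le> d"
  shows "\<bar>coeff P i - coeff R i\<bar> \<le> h"
  using coeff_polys[OF assms(1,3)] coeff_polys[OF assms(2,3)] by linarith

text \<open>For given \<open>y\<close> the abscissa \<open>x\<close> is confined by the range of \<open>c\<^sub>0 + c\<^sub>1 t\<close>. Once \<open>x\<close> is known as
  well, \<open>c\<^sub>1\<close> is known up to \<open>h / t\<close>, which confines the second abscissa.\<close>

lemma coincidences_fst_diff_le: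
  assumes "(p, p') \<in> coincidences Q t s" "(r, r') \<in> coincidences Q t s" "snd p = snd r" "t \<in> points"
  shows "real_of_int (fst p - fst r) \<le> h * T / x_min"
proof -
  obtain P R where same_tail: "P \<in> polys" "R \<in> polys" "poly_shift 2 P = poly_shift 2 R"
    and norms: "norm_form a p = poly P t" "norm_form a r = poly R t"
    and x_min: "x_min \<le> fst p" "x_min \<le> fst r"
    using assms(1,2) by (auto simp: coincidences_def rect_def)
  have "(fst p)\<^sup>2 - (fst r)\<^sup>2 = norm_form a p - norm_form a r"
    using assms(3) by (simp add: norm_form_def)
  also have "\<dots> = (coeff P 0 - coeff R 0) + (coeff P 1 - coeff R 1) * t"
    unfolding norms by (rule poly_diff_same_shift[OF same_tail(3)])
  also have "\<dots> \<le> h + h * t"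
    using abs_coeff_diff_le[OF same_tail(1,2), of 0] abs_coeff_diff_le[OF same_tail(1,2), of 1]
      d_pos assms(4) T_ge_1
    by (intro add_mono mult_right_mono) auto
  also have "\<dots> \<le> h + h * (2 * T - 1)"
    using assms(4) h_pos by (intro add_left_mono mult_left_mono) auto
  finally have "(fst p)\<^sup>2 - (fst r)\<^sup>2 \<le> h * (2 * T)" by (simp add: algebra_simps)
  then have "real_of_int ((fst p)\<^sup>2 - (fst r)\<^sup>2) \<le> real_of_int (h * (2 * T))"
    by (simp only: of_int_le_iff)
  then have "real_of_int (fst p) - real_of_int (fst r) \<le> h * (2 * T) / (2 * x_min)"
    using x_min x_min_pos h_pos T_ge_1 by (intro diff_le_of_squares_diff_le) auto
  then show ?thesis by simp
qed

lemma coincidences_fst_snd_diff_le: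
  assumes "(p, p') \<in> coincidences Q t s" "(p, r') \<in> coincidences Q t s" "snd p' = snd r'" "t \<in> points"
  shows "real_of_int (fst p' - fst r') \<le> real_of_int \<bar>t - s\<bar> * (h / T) / (2 * x_min)"
proof -
  obtain P R where same_tail: "P \<in> polys" "R \<in> polys" "poly_shift 2 P = poly_shift 2 R"
    and norms: "norm_form a p = poly P t" "norm_form a p' = poly P s"
      "norm_form a p = poly R t" "norm_form a r' = poly R s"
    and x_min: "x_min \<le> fst p'" "x_min \<le> fst r'"
    using assms(1,2) by (auto simp: coincidences_def rect_def)
  define c\<^sub>0 c\<^sub>1 where "c\<^sub>0 = coeff P 0 - coeff R 0" and "c\<^sub>1 = coeff P 1 - coeff R 1"
  have "c\<^sub>0 + c\<^sub>1 * t = 0"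
    using poly_diff_same_shift[OF same_tail(3), of t] norms by (simp add: c\<^sub>0_def c\<^sub>1_def)
  then have c\<^sub>0_eq: "c\<^sub>0 = - (c\<^sub>1 * t)" by simp
  have "\<bar>c\<^sub>1\<bar> * T \<le> \<bar>c\<^sub>1\<bar> * t" using assms(4) by (intro mult_left_mono) auto
  also have "\<dots> = \<bar>c\<^sub>0\<bar>" using assms(4) T_ge_1 by (simp add: c\<^sub>0_eq abs_mult)
  also have "\<dots> \<le> h" unfolding c\<^sub>0_def using same_tail by (intro abs_coeff_diff_le) auto
  finally have "real_of_int (\<bar>c\<^sub>1\<bar> * T) \<le> h" by (simp only: of_int_le_iff)
  then have c\<^sub>1_bound: "\<bar>real_of_int c\<^sub>1\<bar> \<le> h / T" using T_ge_1 by (simp add: pos_le_divide_eq)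
  have "(fst p')\<^sup>2 - (fst r')\<^sup>2 = norm_form a p' - norm_form a r'"
    using assms(3) by (simp add: norm_form_def)
  also have "\<dots> = c\<^sub>0 + c\<^sub>1 * s"
    unfolding norms c\<^sub>0_def c\<^sub>1_def by (rule poly_diff_same_shift[OF same_tail(3)])
  also have "\<dots> = c\<^sub>1 * (s - t)" by (simp add: c\<^sub>0_eq algebra_simps)
  also have "\<dots> \<le> \<bar>t - s\<bar> * \<bar>c\<^sub>1\<bar>"
    by (metis abs_ge_self abs_minus_commute abs_mult mult.commute)
  finally have "real_of_int ((fst p')\<^sup>2 - (fst r')\<^sup>2) \<le> real_of_int (\<bar>t - s\<bar> * \<bar>c\<^sub>1\<bar>)"
    by (simp only: of_int_le_iff)
  also have "\<dots> \<le> \<bar>t - s\<bar> * (h / T)"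
    using mult_left_mono[OF c\<^sub>1_bound, of "\<bar>real_of_int t - s\<bar>"] by simp
  finally have "real_of_int (fst p') - real_of_int (fst r') \<le> \<bar>t - s\<bar> * (h / T) / (2 * x_min)"
    using x_min x_min_pos h_pos T_ge_1 by (intro diff_le_of_squares_diff_le) auto
  then show ?thesis by simp
qed

lemma residue_class_factors_le:
  fixes q :: int
  assumes "0 < q" "q \<le> T"
  shows "((x_min / q + 1) * (h * T / x_min / q + 1)) *
    ((x_min / q + 1) * (q * (h / T) / (2 * x_min) / q + 1)) \<le> 8 * (real_of_int h)\<^sup>2 / real_of_int q ^ 3"
proof -
  have pos: "real_of_int q > 0" "real_of_int T > 0" "real_of_int h > 0" "x_min > 0"
    using assms(1) T_ge_1 h_pos x_min_pos by auto
  have "q \<le> x_min" using assms(2) T_le_x_min by linarith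
  then have y_factor: "x_min / q + 1 \<le> 2 * x_min / q"
    using pos by (simp add: field_simps)
  have "x_min * q \<le> x_min * T" using assms(2) x_min_pos by (intro mult_left_mono) auto
  also have "\<dots> \<le> 2 * T * x_min" using pos by simp
  also have "\<dots> \<le> real_of_int h * 1" using T_x_min_le_h by simp
  also have "\<dots> \<le> h * real_of_int T" using h_pos T_ge_1 by (intro mult_left_mono) auto
  finally have x_factor: "h * T / x_min / q + 1 \<le> 2 * h * T / (x_min * q)"
    using pos by (simp add: field_simps)
  have x'_factor: "q * (h / T) / (2 * x_min) / q + 1 \<le> h / (T * x_min)"
    using pos T_x_min_le_h by (simp add: field_simps)
  have "((x_min / q + 1) * (h * T / x_min / q + 1)) *
      ((x_min / q + 1) * (q * (h / T) / (2 * x_min) / q + 1))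
    \<le> ((2 * x_min / q) * (2 * h * T / (x_min * q))) * ((2 * x_min / q) * (h / (T * x_min)))"
    using pos by (intro mult_mono y_factor x_factor x'_factor) auto
  also have "\<dots> = 8 * (real_of_int h)\<^sup>2 / real_of_int q ^ 3"
    using pos by (simp add: field_simps power2_eq_square power3_eq_cube)
  finally show ?thesis .
qed

lemma card_coincidences_residues_le:
  assumes "t \<in> points" "s \<in> points" "t \<noteq> s"
  defines "q \<equiv> \<bar>t - s\<bar>"
  shows "real (card {(p, p') \<in> coincidences Q t s. (residue_pair q p, residue_pair q p') = \<rho>}) \<le>
    8 * (real_of_int h)\<^sup>2 / real_of_int q ^ 3" (is "real (card ?Z) \<le> _")
proof -
  have q_bounds: "q > 0" "q \<le> T" using assms(1-3) by (auto simp: q_def)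
  have "real (card ?Z) \<le> ((x_min / q + 1) * (h * T / x_min / q + 1)) *
    ((x_min / q + 1) * (q * (h / T) / (2 * x_min) / q + 1))"
  proof (rule card_congruent_pairs_le)
    show "finite ?Z" by (rule finite_subset[OF _ finite_coincidences[of Q t s]]) auto
    fix p p' r r' assume "(p, p') \<in> ?Z" "(r, r') \<in> ?Z"
    then have mem: "(p, p') \<in> coincidences Q t s" "(r, r') \<in> coincidences Q t s" by auto
    then have "{snd p, snd r, snd p', snd r'} \<subseteq> {1..y_max}"
      by (auto simp: coincidences_def rect_def)
    then show "snd p - snd r \<le> x_min" "snd p' - snd r' \<le> x_min"
      using y_max_le_x_min by auto
    show "fst p - fst r \<le> h * T / x_min" if "snd p = snd r"
      using mem that assms(1) by (rule coincidences_fst_diff_le)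
  next
    fix p p' r' assume "(p, p') \<in> ?Z" "(p, r') \<in> ?Z" "snd p' = snd r'"
    then have "(p, p') \<in> coincidences Q t s" "(p, r') \<in> coincidences Q t s" "snd p' = snd r'"
      by auto
    then show "fst p' - fst r' \<le> q * (h / T) / (2 * x_min)"
      unfolding q_def using assms(1) by (rule coincidences_fst_snd_diff_le)
  qed (use q_bounds x_min_pos h_pos T_ge_1 in auto)
  also have "\<dots> \<le> 8 * (real_of_int h)\<^sup>2 / real_of_int q ^ 3"
    using q_bounds by (rule residue_class_factors_le)
  finally show ?thesis .
qed

lemma card_coincidences_le:
  assumes "t \<in> points" "s \<in> points" "t \<noteq> s"
  shows "real (card (coincidences Q t s)) \<le> 16 * \<bar>a\<bar> * h\<^sup>2 * inverse_divisor_sum \<bar>t - s\<bar>"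
proof -
  define q where "q = \<bar>t - s\<bar>"
  have "q > 0" using assms by (simp add: q_def)
  let ?res = "\<lambda>(p, p'). (residue_pair q p, residue_pair q p')"
  have "?res ` coincidences Q t s \<subseteq> congruent_norm_pairs a q"
  proof
    fix z assume "z \<in> ?res ` coincidences Q t s"
    then obtain p p' P where z_eq: "z = (residue_pair q p, residue_pair q p')"
      and "norm_form a p = poly P t" "norm_form a p' = poly P s"
      by (auto simp: coincidences_def)
    moreover have "[poly P t = poly P s] (mod q)"
      by (rule cong_poly) (simp add: cong_iff_dvd_diff q_def)
    ultimately have "[norm_form a (residue_pair q p) = norm_form a (residue_pair q p')] (mod q)"
      by (metis cong_sym cong_trans norm_form_residue_pair_cong)
    then show "z \<in> congruent_norm_pairs a q"
      using \<open>q > 0\<close> by (auto simp: z_eq congruent_norm_pairs_def residue_pair_def)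
  qed
  then have "card (coincidences Q t s) =
      (\<Sum>\<rho>\<in>congruent_norm_pairs a q. card {z \<in> coincidences Q t s. ?res z = \<rho>})"
    by (intro card_eq_sum_card_fibres finite_coincidences finite_congruent_norm_pairs)
  also have "real \<dots> \<le> real (card (congruent_norm_pairs a q)) * (8 * h\<^sup>2 / q ^ 3)"
    unfolding of_nat_sum using card_coincidences_residues_le[OF assms, of Q]
    by (intro sum_bounded_above) (simp add: q_def case_prod_unfold)
  also have "\<dots> \<le> (2 * \<bar>a\<bar> * q ^ 3 * inverse_divisor_sum q) * (8 * h\<^sup>2 / q ^ 3)"
    using card_congruent_norm_pairs_le[OF a_nonzero \<open>q > 0\<close>] \<open>q > 0\<close> by (intro mult_right_mono) auto
  also have "\<dots> = 16 * \<bar>a\<bar> * h\<^sup>2 * inverse_divisor_sum q" using \<open>q > 0\<close> by simp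
  finally show ?thesis by (simp add: q_def)
qed

lemma off_diagonal_second_moment:
  assumes "t \<in> points" "s \<in> points" "t \<noteq> s"
  shows "(\<Sum>P\<in>polys. real (card (reps P t) * card (reps P s))) \<le>
    16 * \<bar>a\<bar> * h ^ (d + 1) * inverse_divisor_sum \<bar>t - s\<bar>"
proof -
  let ?tails = "poly_box (d - 1) coeff_range"
  have "poly_shift 2 ` polys \<subseteq> ?tails"
    using d_pos by (auto simp: poly_box_def coeff_poly_shift)
  then have "(\<Sum>P\<in>polys. card (reps P t) * card (reps P s)) =
      (\<Sum>Q\<in>?tails. \<Sum>P | P \<in> polys \<and> poly_shift 2 P = Q. card (reps P t) * card (reps P s))"
    by (intro sum.group[symmetric]) (simp_all add: finite_poly_box)
  also have "\<dots> \<le> (\<Sum>Q\<in>?tails. card (coincidences Q t s))"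
    using assms(3) by (intro sum_mono second_moment_fixed_shift_le)
  also have "real \<dots> \<le> real (card ?tails) * (16 * \<bar>a\<bar> * h\<^sup>2 * inverse_divisor_sum \<bar>t - s\<bar>)"
    unfolding of_nat_sum using card_coincidences_le[OF assms] by (intro sum_bounded_above) auto
  also have "\<dots> = 16 * \<bar>a\<bar> * (h ^ (d - 1) * h\<^sup>2) * inverse_divisor_sum \<bar>t - s\<bar>"
    using h_pos by (simp add: card_poly_box)
  also have "h ^ (d - 1) * h\<^sup>2 = h ^ (d + 1)"
    using d_pos by (simp flip: power_add)
  finally show ?thesis by simp
qed

lemma sum_inverse_divisor_sum_dist_le:
  assumes "t \<in> points"
  shows "(\<Sum>s\<in>points - {t}. inverse_divisor_sum \<bar>t - s\<bar>) \<le> 4 * T"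
proof -
  have mono: "(\<Sum>q\<in>A. inverse_divisor_sum q) \<le> 2 * T" if "A \<subseteq> {1..T}" for A
  proof -
    have "(\<Sum>q\<in>A. inverse_divisor_sum q) \<le> (\<Sum>q = 1..T. inverse_divisor_sum q)"
      using that inverse_divisor_sum_nonneg by (intro sum_mono2) auto
    also have "\<dots> \<le> 2 * T" using T_ge_1 by (intro sum_inverse_divisor_sum_le) simp
    finally show ?thesis .
  qed
  have split: "points - {t} = {T..<t} \<union> {t<..<2 * T}" using assms by auto
  have "(\<Sum>s\<in>points - {t}. inverse_divisor_sum \<bar>t - s\<bar>) =
      (\<Sum>s\<in>{T..<t}. inverse_divisor_sum \<bar>t - s\<bar>) + (\<Sum>s\<in>{t<..<2 * T}. inverse_divisor_sum \<bar>t - s\<bar>)"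
    unfolding split by (rule sum.union_disjoint) auto
  also have "(\<Sum>s\<in>{T..<t}. inverse_divisor_sum \<bar>t - s\<bar>) = (\<Sum>q\<in>{1..t - T}. inverse_divisor_sum q)"
    by (rule sum.reindex_bij_witness[of _ "\<lambda>q. t - q" "\<lambda>s. t - s"]) auto
  also have "(\<Sum>s\<in>{t<..<2 * T}. inverse_divisor_sum \<bar>t - s\<bar>) =
      (\<Sum>q\<in>{1..<2 * T - t}. inverse_divisor_sum q)"
    by (rule sum.reindex_bij_witness[of _ "\<lambda>q. t + q" "\<lambda>s. s - t"]) auto
  finally show ?thesis using mono[of "{1..t - T}"] mono[of "{1..<2 * T - t}"] assms by force
qed

lemma second_moment_fixed_point_le:
  assumes "t \<in> points"
  shows "(\<Sum>s\<in>points. \<Sum>P\<in>polys. real (card (reps P t) * card (reps P s))) \<le>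
    321 * a\<^sup>2 * K\<^sup>2 * h ^ (d + 1) * T"
proof -
  have "(\<Sum>s\<in>points. \<Sum>P\<in>polys. real (card (reps P t) * card (reps P s))) =
      (\<Sum>P\<in>polys. real (card (reps P t) * card (reps P t))) +
      (\<Sum>s\<in>points - {t}. \<Sum>P\<in>polys. real (card (reps P t) * card (reps P s)))"
    using assms by (intro sum.remove) auto
  also have "\<dots> \<le> 257 * 2 ^ d * a\<^sup>2 * K * h ^ (d + 1) * T +
      (\<Sum>s\<in>points - {t}. 16 * \<bar>a\<bar> * h ^ (d + 1) * inverse_divisor_sum \<bar>t - s\<bar>)"
    using assms by (intro add_mono diagonal_second_moment sum_mono off_diagonal_second_moment) auto
  also have "(\<Sum>s\<in>points - {t}. 16 * \<bar>a\<bar> * h ^ (d + 1) * inverse_divisor_sum \<bar>t - s\<bar>) =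
      16 * \<bar>a\<bar> * h ^ (d + 1) * (\<Sum>s\<in>points - {t}. inverse_divisor_sum \<bar>t - s\<bar>)"
    by (simp add: sum_distrib_left)
  also have "\<dots> \<le> 16 * \<bar>a\<bar> * h ^ (d + 1) * real_of_int (4 * T)"
    using sum_inverse_divisor_sum_dist_le[OF assms] h_pos by (intro mult_left_mono) auto
  also have "257 * 2 ^ d * a\<^sup>2 * K * h ^ (d + 1) * T + 16 * \<bar>a\<bar> * h ^ (d + 1) * real_of_int (4 * T) =
      real_of_int ((257 * (2 ^ d * (a\<^sup>2 * K)) + 64 * \<bar>a\<bar>) * (h ^ (d + 1) * T))"
    by (simp add: algebra_simps)
  also have "\<dots> \<le> real_of_int ((257 * (K * (a\<^sup>2 * K)) + 64 * (K * (a\<^sup>2 * K))) * (h ^ (d + 1) * T))"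
  proof -
    have "0 \<le> a\<^sup>2 * K" using square_bound_ge_1[of d] by simp
    then have "2 ^ d * (a\<^sup>2 * K) \<le> K * (a\<^sup>2 * K)" "1 * (a\<^sup>2 * K) \<le> K * (a\<^sup>2 * K)"
      using two_power_le_square_bound[of d] square_bound_ge_1[of d] by (intro mult_right_mono; simp)+
    then show ?thesis
      unfolding of_int_le_iff using abs_a_le_a_sq_K h_pos T_ge_1 by (intro mult_right_mono add_mono) auto
  qed
  also have "\<dots> = 321 * a\<^sup>2 * K\<^sup>2 * h ^ (d + 1) * T"
    by (simp add: power2_eq_square algebra_simps)
  finally show ?thesis by simp
qed

lemma second_moment:
  "(\<Sum>P\<in>polys. (\<Sum>t\<in>points. real (card (reps P t)))\<^sup>2) \<le> 321 * a\<^sup>2 * K\<^sup>2 * h ^ (d + 1) * T\<^sup>2"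
proof -
  have "(\<Sum>P\<in>polys. (\<Sum>t\<in>points. real (card (reps P t)))\<^sup>2) =
      (\<Sum>P\<in>polys. \<Sum>t\<in>points. \<Sum>s\<in>points. real (card (reps P t) * card (reps P s)))"
    by (simp add: power2_eq_square sum_product)
  also have "\<dots> = (\<Sum>t\<in>points. \<Sum>P\<in>polys. \<Sum>s\<in>points. real (card (reps P t) * card (reps P s)))"
    by (rule sum.swap)
  also have "\<dots> = (\<Sum>t\<in>points. \<Sum>s\<in>points. \<Sum>P\<in>polys. real (card (reps P t) * card (reps P s)))"
    by (intro sum.cong refl sum.swap)
  also have "\<dots> \<le> (\<Sum>t\<in>points. real_of_int (321 * a\<^sup>2 * K\<^sup>2 * h ^ (d + 1) * T))"
    using second_moment_fixed_point_le by (intro sum_mono) simp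
  also have "\<dots> = 321 * a\<^sup>2 * K\<^sup>2 * h ^ (d + 1) * T\<^sup>2"
    using T_ge_1 by (simp add: power2_eq_square)
  finally show ?thesis by simp
qed

lemma card_represented_ge:
  "h ^ (d + 1) / represented_const a d \<le> real (card {P \<in> polys. \<exists>t\<in>points. reps P t \<noteq> {}})"
proof -
  define n where "n = (\<lambda>P. \<Sum>t\<in>points. real (card (reps P t)))"
  define k where "k = 2 * real_of_int \<bar>a\<bar> * K"
  define H where "H = real_of_int h ^ (d + 1)"
  let ?N = "real (card {P \<in> polys. n P \<noteq> 0})"
  have pos: "k > 0" "H > 0" "real_of_int T > 0"
    using abs_a_ge_1 square_bound_ge_1[of d] h_pos T_ge_1 by (auto simp: k_def H_def)
  have square: "(T * (H / (8 * sqrt k)))\<^sup>2 = T\<^sup>2 * H * (H / (64 * k))"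
    using pos by (simp add: power_mult_distrib power_divide) (simp add: power2_eq_square)
  have "T * (H / (8 * sqrt k)) = (\<Sum>t\<in>points. H / (8 * sqrt k))" using T_ge_1 by simp
  also have "\<dots> \<le> (\<Sum>t\<in>points. \<Sum>P\<in>polys. real (card (reps P t)))"
    using first_moment by (intro sum_mono) (simp add: H_def k_def)
  also have "\<dots> = (\<Sum>P\<in>polys. n P)" unfolding n_def by (rule sum.swap)
  finally have "(T * (H / (8 * sqrt k)))\<^sup>2 \<le> (\<Sum>P\<in>polys. n P)\<^sup>2"
    using pos by (intro power_mono) auto
  also have "\<dots> \<le> ?N * (\<Sum>P\<in>polys. (n P)\<^sup>2)"
    using finite_polys by (rule sum_squared_le_card_support_mult)
  also have "\<dots> \<le> ?N * (321 * a\<^sup>2 * K\<^sup>2 * H * T\<^sup>2)"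
    using second_moment by (intro mult_left_mono) (auto simp: n_def H_def)
  finally have "T\<^sup>2 * H * (H / (64 * k)) \<le> T\<^sup>2 * H * (?N * (321 * a\<^sup>2 * K\<^sup>2))"
    unfolding square by (simp only: mult_ac)
  then have "H / (64 * k) \<le> ?N * (321 * a\<^sup>2 * K\<^sup>2)"
    by (rule mult_left_le_imp_le) (use pos in simp)
  then have "H \<le> ?N * (321 * a\<^sup>2 * K\<^sup>2) * (64 * k)"
    using pos by (simp add: pos_divide_le_eq)
  also have "\<dots> = ?N * represented_const a d"
    by (simp add: k_def represented_const_def power2_eq_square power3_eq_cube mult_ac)
  finally have "H / represented_const a d \<le> ?N"
    using represented_const_pos[OF a_nonzero, of d] by (simp add: pos_divide_le_eq)
  moreover have "{P \<in> polys. n P \<noteq> 0} = {P \<in> polys. \<exists>t\<in>points. reps P t \<noteq> {}}"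
    by (simp add: n_def sum_nonneg_eq_0_iff finite_reps)
  ultimately show ?thesis by (simp add: H_def)
qed

end

subsection \<open>Polynomials with a small solution\<close>

definition has_solution_up_to :: "int \<Rightarrow> int poly \<Rightarrow> real \<Rightarrow> bool" where
  "has_solution_up_to a P B \<longleftrightarrow> (\<exists>x y z t :: nat. x > 0 \<and> y > 0 \<and> z > 0 \<and> t > 0 \<and>
     (int x)\<^sup>2 - a * (int y)\<^sup>2 = poly P (int t) * (int z)\<^sup>2 \<and> real (Max {x, y, z, t}) \<le> B)"

definition solution_bound :: "int \<Rightarrow> real \<Rightarrow> int poly \<Rightarrow> real" where
  "solution_bound a e P = real_of_int \<bar>a\<bar> powr (1 / 2) * real_of_int (height P) powr (1 / 2) *
     ln (real_of_int (height P)) powr e"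

lemma has_solution_up_to_mono: "has_solution_up_to a P B \<Longrightarrow> B \<le> B' \<Longrightarrow> has_solution_up_to a P B'"
  unfolding has_solution_up_to_def by (meson order_trans)

context conic_family
begin

lemma has_solution_up_to_of_reps:
  assumes "t \<in> points" "reps P t \<noteq> {}"
  shows "has_solution_up_to a P (2 * x_max)"
proof -
  obtain x y :: int where bounds: "x_min \<le> x" "x \<le> x_max" "y \<in> {1..y_max}"
    and representation: "x\<^sup>2 - a * y\<^sup>2 = poly P t"
    using assms(2) by (auto simp: reps_def rect_def)
  have x_max_bounds: "1 \<le> T" "T \<le> x_max" "y_max \<le> x_max"
    using T_ge_1 T_le_x_min x_min_le_x_max y_max_le_x_min by auto
  have "x > 0" "y > 0" "t > 0" using bounds x_min_pos assms(1) x_max_bounds(1) by auto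
  have "\<forall>n\<in>{nat x, nat y, 1, nat t}. real n \<le> 2 * x_max"
    using bounds(2,3) x_max_bounds assms(1) x_max_pos by auto
  moreover have "Max {nat x, nat y, 1, nat t} \<in> {nat x, nat y, 1, nat t}" by (rule Max_in) auto
  ultimately have "real (Max {nat x, nat y, 1, nat t}) \<le> 2 * x_max" by blast
  then show ?thesis
    unfolding has_solution_up_to_def
  proof (intro exI conjI)
    show "nat x > 0" "nat y > 0" "(1 :: nat) > 0" "nat t > 0"
      using \<open>x > 0\<close> \<open>y > 0\<close> \<open>t > 0\<close> by auto
    show "(int (nat x))\<^sup>2 - a * (int (nat y))\<^sup>2 = poly P (int (nat t)) * (int 1)\<^sup>2"
      using \<open>x > 0\<close> \<open>y > 0\<close> \<open>t > 0\<close> representation by simp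
  qed
qed

lemma height_polys_bounds:
  assumes "P \<in> polys"
  shows "h \<le> height P" "height P \<le> 2 * h"
proof -
  have "degree P = d" using degree_poly_box[OF assms] h_pos by simp
  then show "height P \<le> 2 * h"
    unfolding height_le_iff using coeff_polys[OF assms] by force
  show "h \<le> height P"
    using coeff_polys(1)[OF assms, of 0] abs_coeff_le_height[of P 0] by simp
qed

lemma x_max_le_solution_bound:
  assumes "P \<in> polys" "e \<ge> 0" "2 * sqrt (K * T ^ d) \<le> ln h powr e"
  shows "2 * x_max \<le> solution_bound a e P"
proof -
  note height = height_polys_bounds(1)[OF assms(1)]
  have "2 * x_max = sqrt h * (2 * sqrt (K * T ^ d))"
    by (simp add: x_max_def value_min_def real_sqrt_mult)
  also have "\<dots> \<le> sqrt h * ln h powr e"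
    using assms(3) h_pos by (intro mult_left_mono) auto
  also have "\<dots> \<le> sqrt (height P) * ln (height P) powr e"
    using height h_pos assms(2) by (intro mult_mono powr_mono2 ln_mono ln_ge_zero) auto
  also have "\<dots> \<le> \<bar>a\<bar> powr (1 / 2) * (sqrt (height P) * ln (height P) powr e)"
  proof -
    have "1 \<le> real_of_int \<bar>a\<bar> powr (1 / 2)" using abs_a_ge_1 by (simp add: ge_one_powr_ge_zero)
    moreover have "0 \<le> sqrt (height P) * ln (height P) powr e" using height h_pos by simp
    ultimately show ?thesis using mult_right_mono by fastforce
  qed
  also have "sqrt (height P) = height P powr (1 / 2)"
    using height h_pos by (simp add: powr_half_sqrt)
  finally show ?thesis by (simp only: solution_bound_def mult.assoc)
qed

lemma card_polys_with_small_solution_ge: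
  assumes "2 * h \<le> int H" "e \<ge> 0" "2 * sqrt (K * T ^ d) \<le> ln h powr e"
  shows "h ^ (d + 1) / represented_const a d \<le> real (card {P \<in> polys_of_height_at_most d H.
    has_solution_up_to a P (solution_bound a e P)})"
    (is "_ \<le> real (card ?S)")
proof -
  have "{P \<in> polys. \<exists>t\<in>points. reps P t \<noteq> {}} \<subseteq> ?S"
  proof clarify
    fix P t assume mem: "P \<in> polys" "t \<in> points" "reps P t \<noteq> {}"
    have "P \<in> polys_of_height_at_most d H"
      using degree_poly_box[OF mem(1)] height_polys_bounds(2)[OF mem(1)] h_pos assms(1)
      by (simp add: polys_of_height_at_most_def)
    moreover have "has_solution_up_to a P (solution_bound a e P)"
      using has_solution_up_to_of_reps[OF mem(2,3)] x_max_le_solution_bound[OF mem(1) assms(2,3)]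
      by (rule has_solution_up_to_mono)
    ultimately show "P \<in> polys_of_height_at_most d H \<and>
      has_solution_up_to a P (solution_bound a e P)" ..
  qed
  then have "card {P \<in> polys. \<exists>t\<in>points. reps P t \<noteq> {}} \<le> card ?S"
    using finite_polys_of_height_at_most by (intro card_mono) auto
  then show ?thesis using card_represented_ge by linarith
qed

end

lemma eventually_ln_power_le:
  fixes C :: real
  shows "\<forall>\<^sub>F n :: nat in sequentially. C * (2 * ln (real n)) ^ k \<le> real n"
  by real_asymp

lemma eventually_conic_family:
  fixes a :: int
  assumes "a \<noteq> 0" "d > 0"
  shows "\<forall>\<^sub>F n :: nat in sequentially. conic_family a (int n) \<lceil>ln (real n)\<rceil> d"
proof -
  let ?C = "16 * a\<^sup>2 * square_bound d"
  have "\<forall>\<^sub>F n :: nat in sequentially. 1 \<le> ln (real n)" by real_asymp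
  with eventually_ln_power_le[of ?C "d + 2"] show ?thesis
  proof eventually_elim
    case (elim n)
    define T where "T = \<lceil>ln (real n)\<rceil>"
    have T_bounds: "ln (real n) \<le> T" "T \<le> 2 * ln (real n)" "T \<ge> 1"
      using elim(2) unfolding T_def by linarith+
    have "real_of_int (?C * T ^ (d + 2)) \<le> ?C * (2 * ln (real n)) ^ (d + 2)"
      unfolding of_int_mult of_int_power using T_bounds square_bound_ge_1[of d]
      by (intro mult_left_mono power_mono) auto
    then have "?C * T ^ (d + 2) \<le> int n" using elim(1) by linarith
    then have "conic_family a (int n) T d" by unfold_locales (use assms T_bounds in auto)
    then show ?case by (simp add: T_def)
  qed
qed

lemma eventually_sqrt_square_bound_le:
  fixes \<epsilon> :: real
  assumes "\<epsilon> > 0"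
  shows "\<forall>\<^sub>F n :: nat in sequentially.
    2 * sqrt (square_bound d * \<lceil>ln (real n)\<rceil> ^ d) \<le> ln (real n) powr (d / 2 + \<epsilon>)"
proof -
  let ?C = "square_bound d * 2 ^ d"
  have "filterlim (\<lambda>n :: nat. ln (real n) powr \<epsilon>) at_top sequentially"
    using assms by real_asymp
  then have "\<forall>\<^sub>F n :: nat in sequentially. 2 * sqrt ?C \<le> ln (real n) powr \<epsilon>"
    by (simp only: filterlim_at_top)
  moreover have "\<forall>\<^sub>F n :: nat in sequentially. 1 \<le> ln (real n)" by real_asymp
  ultimately show ?thesis
  proof eventually_elim
    case (elim n)
    have "real_of_int (\<lceil>ln (real n)\<rceil> ^ d) \<le> (2 * ln (real n)) ^ d"
      unfolding of_int_power using elim(2) by (intro power_mono) linarith+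
    then have "sqrt (square_bound d * \<lceil>ln (real n)\<rceil> ^ d) \<le> sqrt (?C * ln (real n) ^ d)"
      using square_bound_ge_1[of d]
      by (intro real_sqrt_le_mono) (simp add: power_mult_distrib mult.assoc)
    also have "\<dots> = sqrt ?C * ln (real n) powr (d / 2)"
      using elim(2) by (simp add: real_sqrt_mult powr_half_sqrt[symmetric] powr_realpow[symmetric] powr_powr)
    finally have "2 * sqrt (square_bound d * \<lceil>ln (real n)\<rceil> ^ d) \<le> (2 * sqrt ?C) * ln (real n) powr (d / 2)"
      by simp
    also have "\<dots> \<le> ln (real n) powr \<epsilon> * ln (real n) powr (d / 2)"
      using elim(1) by (intro mult_right_mono) auto
    also have "\<dots> = ln (real n) powr (d / 2 + \<epsilon>)" by (simp add: powr_add)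
    finally show ?case .
  qed
qed

lemma eventually_card_polys_with_small_solution_ge:
  fixes \<epsilon> :: real and a :: int
  assumes "\<epsilon> > 0" "a \<noteq> 0" "d > 0"
  shows "\<forall>\<^sub>F H in sequentially. 1 / (3 ^ Suc d * represented_const a d) * real H ^ Suc d \<le>
    real (card {P \<in> polys_of_height_at_most d H. has_solution_up_to a P (solution_bound a (d / 2 + \<epsilon>) P)})"
proof -
  let ?h = "\<lambda>H :: nat. H div 2"
  have half: "filterlim ?h sequentially sequentially"
    by (rule filterlim_at_top_div_const_nat) simp
  show ?thesis
    using eventually_compose_filterlim[OF eventually_conic_family[OF assms(2,3)] half]
      eventually_compose_filterlim[OF eventually_sqrt_square_bound_le[OF assms(1), of d] half]
      eventually_ge_at_top[of 2]
  proof eventually_elim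
    case (elim H)
    interpret conic_family a "int (?h H)" "\<lceil>ln (real (?h H))\<rceil>" d by (rule elim(1))
    have "H \<le> 3 * ?h H" using elim(3) by presburger
    then have "real H ^ Suc d \<le> (3 * real (?h H)) ^ Suc d" by (intro power_mono) linarith+
    then have "1 / (3 ^ Suc d * represented_const a d) * real H ^ Suc d \<le>
        1 / (3 ^ Suc d * represented_const a d) * (3 * real (?h H)) ^ Suc d"
      using represented_const_pos[OF assms(2), of d] by (intro mult_left_mono) auto
    also have "\<dots> = int (?h H) ^ (d + 1) / represented_const a d"
      by (simp add: power_mult_distrib)
    also have "\<dots> \<le> real (card {P \<in> polys_of_height_at_most d H.
        has_solution_up_to a P (solution_bound a (d / 2 + \<epsilon>) P)})"
      using elim(2) assms(1) by (intro card_polys_with_small_solution_ge) auto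
    finally show ?case .
  qed
qed

theorem corollary1p7:
  fixes \<epsilon> :: real and a :: int and d :: nat
  assumes "\<epsilon> > 0" and "a \<noteq> 0" and "d > 0"
  shows "positive_proportion d (\<lambda>P. \<exists>x y z t :: nat.
           x > 0 \<and> y > 0 \<and> z > 0 \<and> t > 0 \<and>
           (int x)\<^sup>2 - a * (int y)\<^sup>2 = poly P (int t) * (int z)\<^sup>2 \<and>
           real (Max {x, y, z, t}) \<le>
             real_of_int \<bar>a\<bar> powr (1 / 2) * real_of_int (height P) powr (1 / 2) *
             ln (real_of_int (height P)) powr (real d / 2 + \<epsilon>))"
proof -
  have "1 / (3 ^ Suc d * represented_const a d) > 0"
    using represented_const_pos[OF assms(2)] by simp
  then have "positive_proportion d (\<lambda>P. has_solution_up_to a P (solution_bound a (d / 2 + \<epsilon>) P))"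
    using eventually_card_polys_with_small_solution_ge[OF assms] by (rule positive_proportionI)
  then show ?thesis unfolding has_solution_up_to_def solution_bound_def .
qed

end
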